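(* Let $n\ge1$ and let $\mathbb{H}^n$ be the Heisenberg group of homogeneous dimension $Q=2n+2$, with sub-Laplacian $\mathcal{L}_{\mathbb{H}^n}$. Let $f:[0,\infty)\to[0,\infty)$ be continuous and convex with $f(0)=0$ and $f(v)>0$ for $v>0$, such that $$\int_1^{+\infty}\frac{1}{f_m(v)}\,dv<+\infty,\qquad\text{where } f_m(v):=\inf_{\alpha\in(0,1)}\frac{f(\alpha v)}{f(\alpha)} .$$ Let $0\le\varphi\in C[0,+\infty)$. If for every $\varepsilon>0$ $$\int_1^\infty\varphi(\tau)\,\tau^{2n}f(\varepsilon\tau^{-2n})\,d\tau=+\infty ,$$ then for every $0<u_0\in C_0(\mathbb{H}^n)\cap L^1(\mathbb{H}^n)$ there exists no global solution of the Cauchy problem $$u_t(t,x)-\mathcal{L}_{\mathbb{H}^n}u(t,x)=\varphi(t)f(u(t,x)),\quad (t,x)\in\mathbb{R}_+\times\mathbb{H}^n,\qquad u(0,x)=u_0(x),\quad x\in\mathbb{H}^n .$$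
   Context: The Heisenberg group $\mathbb{H}^n\cong\mathbb{C}^n\times\mathbb{R}$ has elements $x=(\xi,\zeta)$, $\xi=g+\mathrm{i}v$ with $g,v\in\mathbb{R}^n$, and group law $(\xi,\zeta)\circ(\xi',\zeta')=(\xi+\xi',\zeta+\zeta'+2\,\mathrm{Im}(\xi\cdot\overline{\xi'}))$. The left-invariant vector fields are $X_i=\partial_{g_i}+2v_i\partial_\zeta$, $Y_i=\partial_{v_i}-2g_i\partial_\zeta$ ($i=1,\dots,n$), and the sub-Laplacian is $\mathcal{L}_{\mathbb{H}^n}=\sum_{i=1}^n(X_i^2+Y_i^2)$. The Haar measure $dx$ is Lebesgue measure. $e^{t\mathcal{L}_{\mathbb{H}^n}}$, $t>0$, is the heat semigroup, $e^{t\mathcal{L}_{\mathbb{H}^n}}g(x)=\int_{\mathbb{H}^n}p_t(y^{-1}x)g(y)\,dy$, with $p_t>0$ the heat kernel of $\partial_t-\mathcal{L}_{\mathbb{H}^n}$. $C_0(\mathbb{H}^n)$ is the space of continuous functions vanishing at infinity; $0<u_0$ means $u_0(x)>0$ for all $x$. Solutions of the Cauchy problem are (positive) functions $u$ satisfying $$u(t,x)=e^{t\mathcal{L}_{\mathbb{H}^n}}u_0(x)+\int_0^t e^{(t-\tau)\mathcal{L}_{\mathbb{H}^n}}\varphi(\tau)f(u(\tau,\cdot))(x)\,d\tau ;$$ the solution is global if it is defined for all $t>0$ and $\|u(t,\cdot)\|_{L^\infty(\mathbb{H}^n)}<\infty$ for all $t>0$. *)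

theory Defs
  imports "HOL-Analysis.Analysis" "HOL-Probability.Essential_Supremum"
begin

section \<open>The Heisenberg group\<close>

text \<open>
  The dimension \<open>n \<ge> 1\<close> is \<open>CARD('n)\<close>; a point is a pair \<open>(\<xi>, \<zeta>)\<close> with
  \<open>\<xi> $ i = g\<^sub>i + \<i> v\<^sub>i\<close>.
\<close>

type_synonym 'n heis = "(complex ^ 'n) \<times> real"

definition hmul :: "'n::finite heis \<Rightarrow> 'n heis \<Rightarrow> 'n heis" where
  "hmul x y = (fst x + fst y, snd x + snd y + 2 * Im (\<Sum>i\<in>UNIV. fst x $ i * cnj (fst y $ i)))"

definition hinv :: "'n::finite heis \<Rightarrow> 'n heis" where
  "hinv x = (- fst x, - snd x)"

lemma hmul_assoc: "hmul (hmul x y) z = hmul x (hmul y z)"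
  by (simp add: hmul_def sum.distrib algebra_simps)

lemma hmul_zero: "hmul 0 x = x" "hmul x 0 = x"
  by (simp_all add: hmul_def)

lemma hmul_hinv: "hmul (hinv x) x = 0" "hmul x (hinv x) = 0"
  by (simp_all add: hmul_def hinv_def zero_prod_def sum_negf)

section \<open>Vector fields and the sub-Laplacian\<close>

definition dirderiv :: "'a::real_normed_vector \<Rightarrow> ('a \<Rightarrow> real) \<Rightarrow> 'a \<Rightarrow> real" where
  "dirderiv e F x = deriv (\<lambda>s. F (x + s *\<^sub>R e)) 0"

definition vfX :: "'n::finite \<Rightarrow> ('n heis \<Rightarrow> real) \<Rightarrow> 'n heis \<Rightarrow> real" where
  "vfX i F x = dirderiv (axis i 1, 0) F x + 2 * Im (fst x $ i) * dirderiv (0, 1) F x"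

definition vfY :: "'n::finite \<Rightarrow> ('n heis \<Rightarrow> real) \<Rightarrow> 'n heis \<Rightarrow> real" where
  "vfY i F x = dirderiv (axis i \<i>, 0) F x - 2 * Re (fst x $ i) * dirderiv (0, 1) F x"

definition sublaplacian :: "('n::finite heis \<Rightarrow> real) \<Rightarrow> 'n heis \<Rightarrow> real" where
  "sublaplacian F x = (\<Sum>i\<in>UNIV. vfX i (vfX i F) x + vfY i (vfY i F) x)"

section \<open>The heat kernel and the heat semigroup\<close>

text \<open>\<open>C_class k S F\<close>: \<open>F\<close> is of class \<open>C\<^sup>k\<close> on the open set \<open>S\<close>.\<close>

primrec C_class :: "nat \<Rightarrow> 'a::euclidean_space set \<Rightarrow> ('a \<Rightarrow> real) \<Rightarrow> bool" where
  "C_class 0 S F \<longleftrightarrow> continuous_on S F"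
| "C_class (Suc k) S F \<longleftrightarrow> F differentiable_on S \<and> (\<forall>e\<in>Basis. C_class k S (dirderiv e F))"

definition smooth_on :: "'a::euclidean_space set \<Rightarrow> ('a \<Rightarrow> real) \<Rightarrow> bool" where
  "smooth_on S F \<longleftrightarrow> (\<forall>k. C_class k S F)"

definition C0 :: "('a::real_normed_vector \<Rightarrow> real) set" where
  "C0 = {g. continuous_on UNIV g \<and> (g \<longlongrightarrow> 0) at_infinity}"

text \<open>
  The heat kernel as the fundamental solution of \<open>\<partial>\<^sub>t - \<L>\<close> with pole at the identity: a smooth
  positive solution of the heat equation for \<open>t > 0\<close>, of total mass one, which converges weakly
  to the Dirac measure at the identity as \<open>t\<close> decreases to \<open>0\<close>. These properties determine
  \<open>p t\<close> for \<open>t > 0\<close>; the values for \<open>t \<le> 0\<close> are irrelevant.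
\<close>

definition heat_kernel :: "(real \<Rightarrow> 'n::finite heis \<Rightarrow> real) \<Rightarrow> bool" where
  "heat_kernel p \<longleftrightarrow>
     smooth_on ({0<..} \<times> UNIV) (\<lambda>(t, x). p t x) \<and>
     (\<forall>t>0. \<forall>x. 0 < p t x) \<and>
     (\<forall>t>0. \<forall>x. ((\<lambda>s. p s x) has_real_derivative sublaplacian (p t) x) (at t)) \<and>
     (\<forall>t>0. has_bochner_integral lborel (p t) 1) \<and>
     (\<forall>g\<in>C0. ((\<lambda>t. LINT y|lborel. p t y * g y) \<longlongrightarrow> g 0) (at_right 0))"

definition heat_semigroup ::
  "(real \<Rightarrow> 'n::finite heis \<Rightarrow> real) \<Rightarrow> real \<Rightarrow> ('n heis \<Rightarrow> real) \<Rightarrow> 'n heis \<Rightarrow> real" where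
  "heat_semigroup p t g x = (LINT y|lborel. p t (hmul (hinv y) x) * g y)"

section \<open>Solutions of the Cauchy problem\<close>

text \<open>
  Positive solutions of the integral equation on the time interval \<open>(0, T)\<close>. Since the Bochner
  integral of a non-integrable function is \<open>0\<close> by convention, the two integrability clauses are
  needed to express that the double integral in the equation is meaningful and finite.
\<close>

definition mild_solution ::
  "(real \<Rightarrow> 'n::finite heis \<Rightarrow> real) \<Rightarrow> (real \<Rightarrow> real) \<Rightarrow> (real \<Rightarrow> real) \<Rightarrow> ('n heis \<Rightarrow> real)
     \<Rightarrow> ereal \<Rightarrow> (real \<Rightarrow> 'n heis \<Rightarrow> real) \<Rightarrow> bool" where
  "mild_solution p \<phi> f u\<^sub>0 T u \<longleftrightarrow>
     (\<forall>t x. 0 < t \<and> ereal t < T \<longrightarrow>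
        0 < u t x \<and>
        (AE \<tau> in lborel. \<tau> \<in> {0<..<t} \<longrightarrow>
           integrable lborel (\<lambda>y. p (t - \<tau>) (hmul (hinv y) x) * (\<phi> \<tau> * f (u \<tau> y)))) \<and>
        set_integrable lborel {0<..<t}
          (\<lambda>\<tau>. heat_semigroup p (t - \<tau>) (\<lambda>y. \<phi> \<tau> * f (u \<tau> y)) x) \<and>
        u t x = heat_semigroup p t u\<^sub>0 x +
          (LINT \<tau>:{0<..<t}|lborel. heat_semigroup p (t - \<tau>) (\<lambda>y. \<phi> \<tau> * f (u \<tau> y)) x))"

text \<open>
  The library's \<open>esssup\<close> is \<open>\<infinity>\<close> on non-measurable functions, so the second clause includes the
  measurability of \<open>u t\<close>.
\<close>

definition global_solution ::
  "(real \<Rightarrow> 'n::finite heis \<Rightarrow> real) \<Rightarrow> (real \<Rightarrow> real) \<Rightarrow> (real \<Rightarrow> real) \<Rightarrow> ('n heis \<Rightarrow> real)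
     \<Rightarrow> (real \<Rightarrow> 'n heis \<Rightarrow> real) \<Rightarrow> bool" where
  "global_solution p \<phi> f u\<^sub>0 u \<longleftrightarrow>
     mild_solution p \<phi> f u\<^sub>0 \<infinity> u \<and>
     (\<forall>t>0. esssup lborel (\<lambda>x. ereal \<bar>u t x\<bar>) < \<infinity>)"

section \<open>The minorant of the nonlinearity\<close>

text \<open>
  For \<open>f\<close> convex on \<open>[0, \<infinity>)\<close>, positive on \<open>(0, \<infinity>)\<close> and with \<open>f 0 = 0\<close>, one has
  \<open>f_minor f v \<ge> v\<close> for \<open>v \<ge> 1\<close>, so that \<open>1 / f_minor f v\<close> never divides by zero there.
\<close>

definition f_minor :: "(real \<Rightarrow> real) \<Rightarrow> real \<Rightarrow> real" where
  "f_minor f v = (INF \<alpha>\<in>{0<..<1}. f (\<alpha> * v) / f \<alpha>)"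

end

theory Submission
  imports Defs
begin

text \<open>
  Let \<open>\<rho>(\<xi>, \<zeta>) = (1 + |\<xi>|\<^sup>4 + \<zeta>\<^sup>2)\<^sup>1\<^sup>/\<^sup>2\<close>; then \<open>\<L>\<rho> \<le> D = 4n + 8\<close>. Testing the heat equation
  against smooth minorants of \<open>w t = max 0 (1 - \<rho> / (2Dt))\<close> shows that the average of \<open>w t\<close> over
  the heat flow of duration \<open>t - \<tau>\<close> from \<open>y\<close> is at least \<open>w \<tau> y / 2\<close>, while
  \<open>\<integral>w t \<le> C t\<^sup>2\<^sup>n\<close> for \<open>t \<ge> 1\<close>. Hence, by Tonelli and Jensen, the weighted mass
  \<open>m t = \<integral>u t \<cdot> w t\<close> of a global solution satisfies, with \<open>V \<tau> = C \<tau>\<^sup>2\<^sup>n\<close>,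
  \<open>m t \<ge> m\<^sub>0 + \<integral>\<^sub>1\<^sup>t \<phi> \<tau> \<cdot> V \<tau> \<cdot> f (m \<tau> / V \<tau>) / 2 d\<tau>\<close>.
  Since \<open>f (m / V) \<ge> f (m\<^sub>0 / V) f_minor (m / m\<^sub>0)\<close>, integrating this differential inequality bounds
  \<open>\<integral>\<^sub>1\<^sup>t \<phi> \<tau> \<cdot> \<tau>\<^sup>2\<^sup>n \<cdot> f (m\<^sub>0 / V \<tau>) d\<tau>\<close> by a multiple of \<open>\<integral>\<^sub>1\<^sup>\<infinity> 1 / f_minor\<close>, uniformly in \<open>t\<close>.
\<close>

section \<open>Integration on the Heisenberg group\<close>

text \<open>The kernel is given only by its characterizing properties, so no Gaussian bound can be
  quoted; the only quantitative information extracted about the heat flow is a lower bound for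
  averages of a compactly supported weight. A fixed weight would lose its mass under the flow. The
  weight must therefore widen with time, and the gauge sets the rate: it is comparable at infinity
  with the square of the homogeneous norm, hence scales like time, and with a radius linear in
  \<open>t\<close> only a fixed factor is lost between any two times. The support then has volume of
  order \<open>t ^ (n + 1)\<close>, half the homogeneous dimension. Since
  \<open>V * f (m / V)\<close> decreases in \<open>V\<close>, this may be enlarged to the power
  \<open>2 * n\<close> of the divergence hypothesis.

  A second obstacle is measurability: \<open>u\<close> is measurable in space at each time, but
  nothing is said about it as a function of both variables. Tonelli is applied to the Duhamel
  integrand instead, which is measurable in time at each point by the integrability clause and
  continuous in space at each time.\<close>

declare split_paired_All [simp del] split_paired_Ex [simp del]

section \<open>Invariance of Lebesgue measure under the group operations\<close>

lemma nn_integral_lborel_translate: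
  fixes f :: "'a::euclidean_space \<Rightarrow> ennreal"
  assumes [measurable]: "f \<in> borel_measurable borel"
  shows "(\<integral>\<^sup>+x. f (a + x) \<partial>lborel) = (\<integral>\<^sup>+x. f x \<partial>lborel)"
proof -
  have "(\<integral>\<^sup>+x. f x \<partial>lborel) = (\<integral>\<^sup>+x. f x \<partial>distr lborel borel ((+) a))"
    by (simp add: lborel_distr_plus)
  also have "\<dots> = (\<integral>\<^sup>+x. f (a + x) \<partial>lborel)"
    by (rule nn_integral_distr) measurable
  finally show ?thesis by simp
qed

text \<open>Left and right translations both have this form, because for a fixed group element the
  twist in the last coordinate depends on the horizontal part alone. Tonelli removes the vertical
  shift first; what remains is a Euclidean translation.\<close>

lemma nn_integral_lborel_shear:
  fixes l :: "'a::euclidean_space \<Rightarrow> real" and f :: "'a \<times> real \<Rightarrow> ennreal"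
  assumes [measurable]: "l \<in> borel_measurable borel" "f \<in> borel_measurable borel"
  shows "(\<integral>\<^sup>+x. f (a + fst x, l (fst x) + snd x) \<partial>lborel) = (\<integral>\<^sup>+x. f x \<partial>lborel)"
proof -
  have f': "f \<in> borel_measurable (borel \<Otimes>\<^sub>M borel)"
    by (simp add: borel_prod)
  have f'': "f \<in> borel_measurable (lborel \<Otimes>\<^sub>M lborel)"
    using assms(2) by (simp add: lborel_prod)
  note [measurable] = f'
  have "(\<integral>\<^sup>+x. f (a + fst x, l (fst x) + snd x) \<partial>lborel)
      = (\<integral>\<^sup>+x. f (a + fst x, l (fst x) + snd x) \<partial>(lborel \<Otimes>\<^sub>M lborel))"
    by (simp add: lborel_prod)
  also have "\<dots> = (\<integral>\<^sup>+x. \<integral>\<^sup>+y. f (a + x, l x + y) \<partial>lborel \<partial>lborel)"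
    by (subst lborel.nn_integral_fst[symmetric]) (simp_all, measurable)
  also have "\<dots> = (\<integral>\<^sup>+x. \<integral>\<^sup>+y. f (a + x, y) \<partial>lborel \<partial>lborel)"
    by (intro nn_integral_cong nn_integral_lborel_translate[of "\<lambda>y. f (a + x, y)" for x]) measurable
  also have "\<dots> = (\<integral>\<^sup>+x. \<integral>\<^sup>+y. f (x, y) \<partial>lborel \<partial>lborel)"
    by (rule nn_integral_lborel_translate[of "\<lambda>x. \<integral>\<^sup>+y. f (x, y) \<partial>lborel"]) measurable
  also have "\<dots> = (\<integral>\<^sup>+x. f x \<partial>(lborel \<Otimes>\<^sub>M lborel))"
    by (rule lborel.nn_integral_fst[OF f''])
  finally show ?thesis by (simp add: lborel_prod)
qed

lemma continuous_on_hmul [continuous_intros]: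
  assumes "continuous_on S f" "continuous_on S g"
  shows "continuous_on S (\<lambda>x. hmul (f x) (g x))"
  unfolding hmul_def by (intro continuous_intros assms)

lemma continuous_on_hinv [continuous_intros]:
  assumes "continuous_on S f"
  shows "continuous_on S (\<lambda>x. hinv (f x))"
  unfolding hinv_def by (intro continuous_intros assms)

lemma hinv_uminus: "hinv x = - x"
  by (simp add: hinv_def prod_eq_iff)

lemma nn_integral_hmul_left:
  fixes f :: "'n::finite heis \<Rightarrow> ennreal"
  assumes [measurable]: "f \<in> borel_measurable borel"
  shows "(\<integral>\<^sup>+x. f (hmul y x) \<partial>lborel) = (\<integral>\<^sup>+x. f x \<partial>lborel)"
proof -
  have l: "(\<lambda>\<xi>::complex^'n. snd y + 2 * Im (\<Sum>i\<in>UNIV. fst y $ i * cnj (\<xi> $ i))) \<in> borel_measurable borel"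
    by (intro borel_measurable_continuous_onI continuous_intros)
  have "hmul y x = (fst y + fst x, (snd y + 2 * Im (\<Sum>i\<in>UNIV. fst y $ i * cnj (fst x $ i))) + snd x)" for x
    by (simp add: hmul_def)
  then show ?thesis
    using nn_integral_lborel_shear[OF l assms, of "fst y"] by presburger
qed

lemma nn_integral_hmul_right:
  fixes f :: "'n::finite heis \<Rightarrow> ennreal"
  assumes [measurable]: "f \<in> borel_measurable borel"
  shows "(\<integral>\<^sup>+x. f (hmul x y) \<partial>lborel) = (\<integral>\<^sup>+x. f x \<partial>lborel)"
proof -
  have l: "(\<lambda>\<xi>::complex^'n. snd y + 2 * Im (\<Sum>i\<in>UNIV. \<xi> $ i * cnj (fst y $ i))) \<in> borel_measurable borel"
    by (intro borel_measurable_continuous_onI continuous_intros)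
  have "hmul x y = (fst y + fst x, (snd y + 2 * Im (\<Sum>i\<in>UNIV. fst x $ i * cnj (fst y $ i))) + snd x)" for x
    by (simp add: hmul_def)
  then show ?thesis
    using nn_integral_lborel_shear[OF l assms, of "fst y"] by presburger
qed

lemma nn_integral_lborel_uminus:
  fixes f :: "'a::euclidean_space \<Rightarrow> ennreal"
  assumes [measurable]: "f \<in> borel_measurable borel"
  shows "(\<integral>\<^sup>+x. f (- x) \<partial>lborel) = (\<integral>\<^sup>+x. f x \<partial>lborel)"
proof -
  have "(\<integral>\<^sup>+x. f x \<partial>lborel)
      = (\<integral>\<^sup>+x. f x \<partial>density (distr lborel borel (\<lambda>x::'a. 0 + (-1) *\<^sub>R x)) (\<lambda>_. \<bar>- 1::real\<bar> ^ DIM('a)))"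
    by (subst lborel_affine[of "- 1::real" "0::'a"]) simp_all
  also have "\<dots> = (\<integral>\<^sup>+x. f (- x) \<partial>lborel)"
    by (subst nn_integral_density) (simp_all add: nn_integral_distr)
  finally show ?thesis by simp
qed

text \<open>The convolution integrates over the inverted factor. Group inversion is the reflection
  at the origin, which reduces the claim to a right translation.\<close>

lemma nn_integral_hmul_hinv:
  fixes f :: "'n::finite heis \<Rightarrow> ennreal"
  assumes [measurable]: "f \<in> borel_measurable borel"
  shows "(\<integral>\<^sup>+y. f (hmul (hinv y) x) \<partial>lborel) = (\<integral>\<^sup>+y. f y \<partial>lborel)"
proof -
  have [measurable]: "(\<lambda>y. f (hmul y x)) \<in> borel_measurable borel"
    by (rule measurable_compose[OF borel_measurable_continuous_onI assms])
       (intro continuous_intros)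
  have "(\<integral>\<^sup>+y. f (hmul (hinv y) x) \<partial>lborel) = (\<integral>\<^sup>+y. f (hmul y x) \<partial>lborel)"
    unfolding hinv_uminus by (rule nn_integral_lborel_uminus[of "\<lambda>y. f (hmul y x)"]) simp
  then show ?thesis
    using nn_integral_hmul_right[of f x] by simp
qed

lemma lborel_distr_hmul_right:
  fixes y :: "'n::finite heis"
  shows "distr lborel borel (\<lambda>x. hmul x y) = lborel"
proof (rule measure_eqI)
  have [measurable]: "(\<lambda>x. hmul x y) \<in> borel_measurable borel"
    by (intro borel_measurable_continuous_onI continuous_intros)
  fix A assume "A \<in> sets (distr lborel borel (\<lambda>x. hmul x y))"
  then have [measurable]: "A \<in> sets borel" by simp
  show "emeasure (distr lborel borel (\<lambda>x. hmul x y)) A = emeasure lborel A"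
    using nn_integral_distr[of "\<lambda>x. hmul x y" lborel borel "indicator A"] nn_integral_hmul_right[of "indicator A" y]
    by simp
qed simp

text \<open>Replace \<open>x\<close> by simple functions \<open>F i x\<close> tending to
  \<open>x\<close>: only finitely many points then occur, so measurability in \<open>t\<close>
  suffices, and continuity in \<open>x\<close> passes it to the limit. This supplies the joint
  measurability that Tonelli needs for the Duhamel term.\<close>

lemma borel_measurable_Caratheodory:
  fixes h :: "'a \<Rightarrow> 'b::{metric_space, second_countable_topology} \<Rightarrow> real"
  assumes m: "\<And>x. (\<lambda>t. h t x) \<in> borel_measurable M"
    and c: "\<And>t. t \<in> space M \<Longrightarrow> continuous_on UNIV (h t)"
  shows "(\<lambda>(t, x). h t x) \<in> borel_measurable (M \<Otimes>\<^sub>M borel)"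
proof -
  obtain F :: "nat \<Rightarrow> 'b \<Rightarrow> 'b" where F: "\<And>i. simple_function borel (F i)" "\<And>x. (\<lambda>i. F i x) \<longlonglongrightarrow> x"
    using borel_measurable_implies_sequence_metric[of "\<lambda>x::'b. x" borel undefined] that by auto
  have "(\<lambda>z. h (fst z) (F i (snd z))) \<in> borel_measurable (M \<Otimes>\<^sub>M borel)" for i
  proof -
    have "countable (range (F i))"
      using F(1)[of i] by (simp add: simple_function_def countable_finite)
    moreover have "F i \<in> borel \<rightarrow>\<^sub>M count_space (range (F i))"
      using F(1)[of i] by (subst measurable_count_space_eq2) (auto simp: simple_function_def)
    ultimately show ?thesis
      using m
      by (intro measurable_compose_countable'[where I = "range (F i)" and f = "\<lambda>x z. h (fst z) x" and g = "\<lambda>z. F i (snd z)"])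
         (auto intro: measurable_compose[OF measurable_fst] measurable_compose[OF measurable_snd])
  qed
  moreover have "(\<lambda>i. h (fst z) (F i (snd z))) \<longlonglongrightarrow> h (fst z) (snd z)"
    if "z \<in> space (M \<Otimes>\<^sub>M borel)" for z
  proof -
    have "isCont (h (fst z)) (snd z)"
      using c[of "fst z"] that by (auto simp: space_pair_measure continuous_on_eq_continuous_at)
    then show ?thesis
      by (rule isCont_tendsto_compose) (rule F)
  qed
  ultimately have "(\<lambda>z. h (fst z) (snd z)) \<in> borel_measurable (M \<Otimes>\<^sub>M borel)"
    by (rule borel_measurable_LIMSEQ_real[rotated])
  then show ?thesis by (simp add: case_prod_beta')
qed

lemma integrable_hmul_hinv:
  fixes q :: "'n::finite heis \<Rightarrow> real"
  assumes q: "continuous_on UNIV q" "integrable lborel q"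
  shows "integrable lborel (\<lambda>y. q (hmul (hinv y) x))"
proof -
  have [measurable]: "q \<in> borel_measurable borel"
    using q(1) by (rule borel_measurable_continuous_onI)
  have "(\<lambda>y. q (hmul (hinv y) x)) \<in> borel_measurable borel"
    by (intro borel_measurable_continuous_onI continuous_on_compose2[OF q(1)] continuous_intros) auto
  then show ?thesis
    using q(2) nn_integral_hmul_hinv[of "\<lambda>y. ennreal (norm (q y))" x]
    by (simp add: integrable_iff_bounded)
qed

text \<open>Scheffe's lemma gives the continuity of translation in \<open>L\<^sup>1\<close>.\<close>

lemma continuous_convolution:
  fixes q F :: "'n::finite heis \<Rightarrow> real"
  assumes q: "continuous_on UNIV q" "integrable lborel q"
    and F: "F \<in> borel_measurable borel" "AE y in lborel. \<bar>F y\<bar> \<le> B"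
  shows "integrable lborel (\<lambda>y. q (hmul (hinv y) x) * F y)"
    and "continuous_on UNIV (\<lambda>x. LINT y|lborel. q (hmul (hinv y) x) * F y)"
proof -
  let ?q = "\<lambda>x y. q (hmul (hinv y) x)"
  note [measurable] = F(1)
  have qm [measurable]: "?q x \<in> borel_measurable borel" for x
    by (intro borel_measurable_continuous_onI continuous_on_compose2[OF q(1)] continuous_intros) auto
  have qi: "integrable lborel (?q x)" for x
    by (rule integrable_hmul_hinv[OF q])
  have int: "integrable lborel (\<lambda>y. ?q x y * F y)" for x
  proof (rule Bochner_Integration.integrable_bound)
    show "integrable lborel (\<lambda>y. B * ?q x y)" using qi by simp
    show "AE y in lborel. norm (?q x y * F y) \<le> norm (B * ?q x y)"
      using F(2) by eventually_elim (auto simp: abs_mult mult.commute intro!: mult_right_mono)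
  qed simp
  then show "integrable lborel (\<lambda>y. ?q x y * F y)" .
  show "continuous_on UNIV (\<lambda>x. LINT y|lborel. ?q x y * F y)"
    unfolding continuous_on_sequentially
  proof (intro allI ballI impI, elim conjE)
    fix X :: "nat \<Rightarrow> 'n heis" and a
    assume X: "X \<longlonglongrightarrow> a"
    have "(\<lambda>n. \<integral>\<^sup>+ y. norm (?q (X n) y - ?q a y) \<partial>lborel) \<longlonglongrightarrow> 0"
    \<comment> \<open>Invariance gives all translates the same norm in L1, so the condition on norms
      holds with equality.\<close>
    proof (rule Scheffe_lemma2)
      show "AE y in lborel. (\<lambda>n. ?q (X n) y) \<longlonglongrightarrow> ?q a y"
      proof (rule AE_I2)
        fix y
        have "continuous_on UNIV (\<lambda>x. ?q x y)"
          by (intro continuous_on_compose2[OF q(1)] continuous_intros) auto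
        then have "isCont (\<lambda>x. ?q x y) a"
          by (cases a) (simp add: continuous_on_eq_continuous_at)
        then show "(\<lambda>n. ?q (X n) y) \<longlonglongrightarrow> ?q a y"
          using X by (rule isCont_tendsto_compose)
      qed
      show "(\<integral>\<^sup>+ y. norm (?q (X n) y) \<partial>lborel) \<le> (\<integral>\<^sup>+ y. norm (?q a y) \<partial>lborel)" for n
        using nn_integral_hmul_hinv[of "\<lambda>y. ennreal (norm (q y))"]
          borel_measurable_continuous_onI[OF q(1)] by simp
    qed (auto intro: qi)
    then have "(\<lambda>n. ennreal (LINT y|lborel. \<bar>?q (X n) y - ?q a y\<bar>)) \<longlonglongrightarrow> ennreal 0"
      using qi by (subst (asm) nn_integral_eq_integral) auto
    then have lim: "(\<lambda>n. LINT y|lborel. \<bar>?q (X n) y - ?q a y\<bar>) \<longlonglongrightarrow> 0"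
      by (subst (asm) tendsto_ennreal_iff) auto
    have "(\<lambda>n. (LINT y|lborel. ?q (X n) y * F y) - (LINT y|lborel. ?q a y * F y)) \<longlonglongrightarrow> 0"
    proof (rule Lim_null_comparison)
      show "(\<lambda>n. B * (LINT y|lborel. \<bar>?q (X n) y - ?q a y\<bar>)) \<longlonglongrightarrow> 0"
        using tendsto_mult_right_zero[OF lim] by simp
      show "\<forall>\<^sub>F n in sequentially. norm ((LINT y|lborel. ?q (X n) y * F y) - (LINT y|lborel. ?q a y * F y))
              \<le> B * (LINT y|lborel. \<bar>?q (X n) y - ?q a y\<bar>)"
      proof (rule always_eventually, rule allI)
        fix n
        have "norm ((LINT y|lborel. ?q (X n) y * F y) - (LINT y|lborel. ?q a y * F y))
            = norm (LINT y|lborel. ?q (X n) y * F y - ?q a y * F y)"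
          using int by simp
        also have "\<dots> \<le> (LINT y|lborel. norm (?q (X n) y * F y - ?q a y * F y))"
          by (rule integral_norm_bound)
        also have "\<dots> \<le> (LINT y|lborel. B * \<bar>?q (X n) y - ?q a y\<bar>)"
        proof (rule integral_mono_AE)
          show "integrable lborel (\<lambda>y. norm (?q (X n) y * F y - ?q a y * F y))"
            by (intro Bochner_Integration.integrable_norm Bochner_Integration.integrable_diff int)
          show "integrable lborel (\<lambda>y. B * \<bar>?q (X n) y - ?q a y\<bar>)"
            using qi by auto
          show "AE y in lborel. norm (?q (X n) y * F y - ?q a y * F y) \<le> B * \<bar>?q (X n) y - ?q a y\<bar>"
            using F(2)
          proof eventually_elim
            case (elim y)
            have "norm (?q (X n) y * F y - ?q a y * F y) = \<bar>F y\<bar> * \<bar>?q (X n) y - ?q a y\<bar>"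
              by (simp add: left_diff_distrib[symmetric] abs_mult)
            also have "\<dots> \<le> B * \<bar>?q (X n) y - ?q a y\<bar>"
              by (rule mult_right_mono[OF elim]) simp
            finally show ?case .
          qed
        qed
        finally show "norm ((LINT y|lborel. ?q (X n) y * F y) - (LINT y|lborel. ?q a y * F y))
              \<le> B * (LINT y|lborel. \<bar>?q (X n) y - ?q a y\<bar>)" by simp
      qed
    qed
    then show "((\<lambda>x. LINT y|lborel. ?q x y * F y) \<circ> X) \<longlonglongrightarrow> (LINT y|lborel. ?q a y * F y)"
      unfolding o_def by (rule LIM_zero_cancel)
  qed
qed

section \<open>Derivatives along the left-invariant flows\<close>

text \<open>The vertical coefficient of the left-invariant field with horizontal direction
  \<open>a\<close>. The directions \<open>axis i 1\<close> and \<open>axis i \<i>\<close> give the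
  coefficients of X and Y, so both families are treated as one.\<close>

definition twist :: "complex ^ 'n::finite \<Rightarrow> 'n heis \<Rightarrow> real" where
  "twist a x = 2 * Im (\<Sum>i\<in>UNIV. fst x $ i * cnj (a $ i))"

definition hfield :: "complex ^ 'n::finite \<Rightarrow> ('n heis \<Rightarrow> real) \<Rightarrow> 'n heis \<Rightarrow> real" where
  "hfield a F x = dirderiv (a, 0) F x + twist a x * dirderiv (0, 1) F x"

text \<open>Differentiation along right multiplication by a one-parameter subgroup. Stated as a
  relation between functions, it has sum, product and chain rules of one real variable, and
  regularity in other directions does not enter.\<close>

definition flow_deriv :: "complex ^ 'n::finite \<Rightarrow> ('n heis \<Rightarrow> real) \<Rightarrow> ('n heis \<Rightarrow> real) \<Rightarrow> bool" where
  "flow_deriv a F F' \<longleftrightarrow> (\<forall>x. ((\<lambda>s. F (hmul x (s *\<^sub>R a, 0))) has_real_derivative F' x) (at 0))"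

lemma hmul_flow: "hmul x (s *\<^sub>R a, 0) = x + s *\<^sub>R (a, twist a x)"
  by (simp add: hmul_def twist_def prod_eq_iff sum_distrib_left algebra_simps)

text \<open>\<open>a $ i * cnj (a $ i)\<close> is real, so the vertical coefficient is constant
  along its own flow. Hence flow times add up, and a second derivative along the flow gets no term
  from differentiating the coefficient.\<close>

lemma twist_flow: "twist a (x + s *\<^sub>R (a, c)) = twist a x"
  by (simp add: twist_def algebra_simps sum.distrib)

lemma linear_twist: "linear (twist a)"
  by (rule linearI) (simp_all add: twist_def algebra_simps sum.distrib sum_distrib_left)

lemma hmul_flow_add:
  "hmul (hmul x (s *\<^sub>R a, 0)) (t *\<^sub>R a, 0) = hmul x ((s + t) *\<^sub>R a, 0)"
  unfolding hmul_flow twist_flow by (simp add: algebra_simps)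

lemma sum_axis_cnj: "(\<Sum>j\<in>UNIV. (f j :: complex) * cnj (axis i b $ j)) = f i * cnj b"
proof -
  have "(\<Sum>j\<in>UNIV. f j * cnj (axis i b $ j)) = (\<Sum>j\<in>UNIV. if j = i then f i * cnj b else 0)"
    by (intro sum.cong) (auto simp: axis_def)
  then show ?thesis by simp
qed

lemma vfX_eq: "vfX i = hfield (axis i 1)"
  by (intro ext) (simp add: vfX_def hfield_def twist_def sum_axis_cnj)

lemma vfY_eq: "vfY i = hfield (axis i \<i>)"
  by (intro ext) (simp add: vfY_def hfield_def twist_def sum_axis_cnj)

lemma flow_deriv_at:
  assumes "flow_deriv a F F'"
  shows "((\<lambda>s. F (hmul x (s *\<^sub>R a, 0))) has_real_derivative F' (hmul x (t *\<^sub>R a, 0))) (at t)"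
proof -
  have "((\<lambda>s. F (hmul x ((t + s) *\<^sub>R a, 0))) has_real_derivative F' (hmul x (t *\<^sub>R a, 0))) (at 0)"
    using assms unfolding flow_deriv_def hmul_flow_add[symmetric] by blast
  then show ?thesis
    using DERIV_shift[of "\<lambda>s. F (hmul x (s *\<^sub>R a, 0))" _ 0 t] by (simp add: add.commute)
qed

text \<open>Left invariance of the fields: the flow multiplies from the right, so associativity
  suffices.\<close>

lemma flow_deriv_left_translate:
  "flow_deriv a F F' \<Longrightarrow> flow_deriv a (\<lambda>z. F (hmul y z)) (\<lambda>z. F' (hmul y z))"
  by (simp add: flow_deriv_def hmul_assoc[symmetric])

lemma flow_deriv_add:
  "flow_deriv a F F' \<Longrightarrow> flow_deriv a G G' \<Longrightarrow> flow_deriv a (\<lambda>x. F x + G x) (\<lambda>x. F' x + G' x)"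
  by (auto simp: flow_deriv_def intro!: derivative_eq_intros)

lemma flow_deriv_diff:
  "flow_deriv a F F' \<Longrightarrow> flow_deriv a G G' \<Longrightarrow> flow_deriv a (\<lambda>x. F x - G x) (\<lambda>x. F' x - G' x)"
  by (auto simp: flow_deriv_def intro!: derivative_eq_intros)

lemma flow_deriv_mult:
  assumes "flow_deriv a F F'" "flow_deriv a G G'"
  shows "flow_deriv a (\<lambda>x. F x * G x) (\<lambda>x. F' x * G x + F x * G' x)"
  unfolding flow_deriv_def
proof
  fix x
  have "((\<lambda>s. F (hmul x (s *\<^sub>R a, 0)) * G (hmul x (s *\<^sub>R a, 0))) has_real_derivative
      F' x * G (hmul x (0 *\<^sub>R a, 0)) + G' x * F (hmul x (0 *\<^sub>R a, 0))) (at 0)"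
    using assms by (intro DERIV_mult) (auto simp: flow_deriv_def)
  then show "((\<lambda>s. F (hmul x (s *\<^sub>R a, 0)) * G (hmul x (s *\<^sub>R a, 0))) has_real_derivative
      F' x * G x + F x * G' x) (at 0)"
    by (simp add: hmul_zero zero_prod_def[symmetric] mult.commute)
qed

lemma flow_deriv_twist: "flow_deriv a (twist a) (\<lambda>_. 0)"
  unfolding flow_deriv_def hmul_flow twist_flow by simp

lemma flow_deriv_compose:
  assumes "flow_deriv a F F'" "\<And>x. (g has_real_derivative g' (F x)) (at (F x))"
  shows "flow_deriv a (\<lambda>x. g (F x)) (\<lambda>x. g' (F x) * F' x)"
  unfolding flow_deriv_def
proof
  fix x
  have "((\<lambda>s. g (F (hmul x (s *\<^sub>R a, 0)))) has_real_derivative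
      g' (F (hmul x (0 *\<^sub>R a, 0))) * F' x) (at 0)"
    using assms(1)
    by (intro DERIV_chain2[where g = "\<lambda>s. F (hmul x (s *\<^sub>R a, 0))"] assms(2)) (auto simp: flow_deriv_def)
  then show "((\<lambda>s. g (F (hmul x (s *\<^sub>R a, 0)))) has_real_derivative g' (F x) * F' x) (at 0)"
    by (simp add: hmul_zero zero_prod_def[symmetric])
qed

lemma flow_deriv_unique: "flow_deriv a F F' \<Longrightarrow> flow_deriv a F F'' \<Longrightarrow> F' = F''"
  by (auto simp: flow_deriv_def intro: DERIV_unique)

lemma has_derivative_line:
  assumes "(F has_derivative D) (at x)"
  shows "((\<lambda>s. F (x + s *\<^sub>R e)) has_real_derivative D e) (at 0)"
proof -
  have "((\<lambda>s. F (x + s *\<^sub>R e)) has_derivative (\<lambda>s. D (s *\<^sub>R e))) (at 0)"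
    by (rule has_derivative_compose[of "\<lambda>s. x + s *\<^sub>R e" "\<lambda>s. s *\<^sub>R e"])
       (auto intro!: derivative_eq_intros assms)
  moreover have "D (s *\<^sub>R e) = D e * s" for s
    using has_derivative_bounded_linear[OF assms] by (simp add: linear_simps)
  ultimately show ?thesis by (simp add: has_field_derivative_def)
qed

lemma dirderiv_eq: "(F has_derivative D) (at x) \<Longrightarrow> dirderiv e F x = D e"
  unfolding dirderiv_def by (intro DERIV_imp_deriv has_derivative_line)

lemma flow_deriv_hfield:
  assumes "\<And>x. F differentiable (at x)"
  shows "flow_deriv a F (hfield a F)"
  unfolding flow_deriv_def
proof
  fix x
  obtain D where D: "(F has_derivative D) (at x)"
    using assms[of x] by (auto simp: differentiable_def)
  then interpret D: bounded_linear D by (rule has_derivative_bounded_linear)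
  have "D (a, twist a x) = D ((a, 0) + twist a x *\<^sub>R (0, 1))" by simp
  also have "\<dots> = hfield a F x"
    unfolding D.add D.scaleR by (simp add: hfield_def dirderiv_eq[OF D])
  finally show "((\<lambda>s. F (hmul x (s *\<^sub>R a, 0))) has_real_derivative hfield a F x) (at 0)"
    unfolding hmul_flow using has_derivative_line[OF D, of "(a, twist a x)"] by simp
qed

lemma C_class_imp_continuous: "C_class k S F \<Longrightarrow> continuous_on S F"
  by (cases k) (auto dest: differentiable_imp_continuous_on)

lemma C_class_slice:
  fixes P :: "real \<times> 'a::euclidean_space \<Rightarrow> real"
  assumes "C_class k ({0<..} \<times> UNIV) P" "t > 0"
  shows "C_class k UNIV (\<lambda>x. P (t, x))"
  using assms(1)
proof (induction k arbitrary: P)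
  case 0
  then show ?case
    using assms(2) by (auto intro!: continuous_on_compose2[of "{0<..} \<times> UNIV" P] continuous_intros)
next
  case (Suc k)
  have "P differentiable (at (t, x))" for x
    using Suc.prems assms(2)
    by (auto simp: differentiable_on_eq_differentiable_at open_Times)
  then have "(\<lambda>x. P (t, x)) differentiable (at x)" for x
    by (intro differentiable_compose[of P "\<lambda>x. (t, x)"])
       (auto simp: differentiable_def intro!: exI derivative_eq_intros)
  moreover have "C_class k UNIV (dirderiv e (\<lambda>x. P (t, x)))" if "e \<in> Basis" for e
  proof -
    have "(0, e) \<in> (Basis :: (real \<times> 'a) set)"
      using that by (simp add: Basis_prod_def)
    then have "C_class k UNIV (\<lambda>x. dirderiv (0, e) P (t, x))"
      using Suc by simp
    then show ?thesis by (simp add: dirderiv_def[abs_def])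
  qed
  ultimately show ?case
    by (simp add: differentiable_on_def)
qed

lemma C_class_hfield:
  fixes q :: "'n::finite heis \<Rightarrow> real" and i :: 'n
  assumes q: "C_class 2 UNIV q" and b: "b \<in> {1, \<i>}"
  defines "a \<equiv> axis i b"
  shows "flow_deriv a q (hfield a q)" "flow_deriv a (hfield a q) (hfield a (hfield a q))"
    "continuous_on UNIV (hfield a q)" "continuous_on UNIV (hfield a (hfield a q))"
proof -
  \<comment> \<open>\<open>C_class\<close> controls derivatives in basis directions only; this is
    why \<open>b\<close> is restricted to 1 and \<open>\<i>\<close>.\<close>
  have e: "(a, 0) \<in> (Basis :: 'n heis set)" "(0, 1) \<in> (Basis :: 'n heis set)"
    using b by (auto simp: a_def Basis_prod_def Basis_vec_def Basis_complex_def)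
  let ?D1 = "dirderiv (a, 0) q" and ?D2 = "dirderiv (0, 1) q"
  have q': "C_class (Suc (Suc 0)) UNIV q" using q by (simp add: numeral_2_eq_2)
  have 1: "q differentiable (at x)" "?D1 differentiable (at x)" "?D2 differentiable (at x)" for x
    using q' e by (auto simp: differentiable_on_def)
  have tw: "twist a differentiable (at x)" for x
    by (rule linear_imp_differentiable[OF linear_twist])
  have 2: "hfield a q differentiable (at x)" for x
    unfolding hfield_def[abs_def] by (intro differentiable_add differentiable_mult 1 tw)
  show f: "flow_deriv a q (hfield a q)" "flow_deriv a (hfield a q) (hfield a (hfield a q))"
    by (intro flow_deriv_hfield 1 2)+
  show "continuous_on UNIV (hfield a q)"
    using 2 by (intro differentiable_imp_continuous_on) (auto simp: differentiable_on_def)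
  have "flow_deriv a (hfield a q) (\<lambda>x. hfield a ?D1 x + (0 * ?D2 x + twist a x * hfield a ?D2 x))"
    unfolding hfield_def[of a q, abs_def]
    by (intro flow_deriv_add flow_deriv_mult flow_deriv_twist flow_deriv_hfield 1)
  \<comment> \<open>The product rule yields a second formula for the same flow derivative. By
    uniqueness the iterated field is expressed through second-order partials, whose continuity is
    part of \<open>C_class\<close>.\<close>
  then have eq: "hfield a (hfield a q) = (\<lambda>x. hfield a ?D1 x + (0 * ?D2 x + twist a x * hfield a ?D2 x))"
    by (rule flow_deriv_unique[OF f(2)])
  have ct: "continuous_on UNIV (twist a)"
    by (rule linear_continuous_on) (simp add: linear_conv_bounded_linear[symmetric] linear_twist)
  have cd: "continuous_on UNIV (dirderiv e' (dirderiv e q))"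
    if "e \<in> Basis" "e' \<in> Basis" for e e'
    using q' that by auto
  show "continuous_on UNIV (hfield a (hfield a q))"
    unfolding eq mult_zero_left add_0_left hfield_def[of a ?D1, abs_def] hfield_def[of a ?D2, abs_def]
    by (intro continuous_on_add continuous_on_mult ct cd e)
qed

section \<open>Integration by parts along the flows\<close>

lemma lborel_integral_eq_integral_cbox:
  fixes F :: "'a::euclidean_space \<Rightarrow> real"
  assumes "continuous_on UNIV F" "\<And>x. x \<notin> cbox l u \<Longrightarrow> F x = 0"
  shows "integrable lborel F" "(LINT x|lborel. F x) = integral (cbox l u) F"
proof -
  have eq: "(\<lambda>x. indicator (cbox l u) x *\<^sub>R F x) = F"
    using assms(2) by (auto simp: fun_eq_iff indicator_def)
  have *: "set_integrable lborel (cbox l u) F"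
    unfolding set_integrable_def
    by (intro borel_integrable_compact compact_cbox continuous_on_subset[OF assms(1)]) auto
  then show "integrable lborel F" unfolding set_integrable_def eq .
  show "(LINT x|lborel. F x) = integral (cbox l u) F"
    using set_borel_integral_eq_integral(2)[OF *] unfolding set_lebesgue_integral_def eq .
qed

text \<open>The flow consists of right translations, which preserve Lebesgue measure, so the
  integral of \<open>F\<close> moved by the flow is constant in the flow time. Differentiation under
  the integral at time 0 gives the claim.\<close>

lemma integral_flow_deriv_eq_0:
  fixes F F' :: "'n::finite heis \<Rightarrow> real"
  assumes d: "flow_deriv a F F'" and c: "continuous_on UNIV F" "continuous_on UNIV F'"
    and S: "bounded S" "\<And>x. x \<notin> S \<Longrightarrow> F x = 0"
  shows "(LINT x|lborel. F' x) = 0"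
proof -
  let ?\<Phi> = "\<lambda>s x. hmul x (s *\<^sub>R a, 0) :: 'n heis"
  \<comment> \<open>All positions of the support for flow times in [-1, 1]: one box then serves
    every time near 0, as differentiation under the integral requires.\<close>
  define K where "K = (\<lambda>z. ?\<Phi> (fst z) (snd z)) ` ({-1..1} \<times> closure S)"
  have cK: "compact K"
    unfolding K_def using S(1)
    by (intro compact_continuous_image compact_Times continuous_intros) auto
  then obtain l u where lu: "K \<subseteq> cbox l u"
    using bounded_subset_cbox_symmetric[OF compact_imp_bounded[OF cK]] by metis
  have F0: "F (?\<Phi> s x) = 0" if "x \<notin> cbox l u" "s \<in> {-1..1}" for s x
  proof (rule ccontr)
    assume "F (?\<Phi> s x) \<noteq> 0"
    then have "?\<Phi> s x \<in> closure S" using S(2) closure_subset by blast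
    moreover have "x = ?\<Phi> (- s) (?\<Phi> s x)"
      unfolding hmul_flow_add by (simp add: hmul_zero zero_prod_def[symmetric])
    ultimately have "x \<in> K"
      unfolding K_def using that(2) by (intro image_eqI[of _ _ "(- s, ?\<Phi> s x)"]) auto
    with lu that(1) show False by auto
  qed
  have F'0: "F' x = 0" if "x \<notin> cbox l u" for x
  proof -
    have "((\<lambda>s. F (?\<Phi> s x)) has_real_derivative F' x) (at 0)"
      using d by (simp add: flow_deriv_def)
    then have "((\<lambda>s. 0) has_real_derivative F' x) (at 0)"
      by (rule has_field_derivative_transform_within_open[where S = "{-1<..<1}"])
         (use F0[OF that] in auto)
    then show ?thesis using DERIV_const DERIV_unique by blast
  qed
  have cs: "continuous_on UNIV (\<lambda>x. F (?\<Phi> s x))" for s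
    by (intro continuous_on_compose2[OF c(1)] continuous_intros) auto
  have const: "integral (cbox l u) (\<lambda>x. F (?\<Phi> s x)) = (LINT x|lborel. F x)" if "s \<in> {-1<..<1}" for s
  proof -
    have "integral (cbox l u) (\<lambda>x. F (?\<Phi> s x)) = (LINT x|lborel. F (?\<Phi> s x))"
      using that F0 by (intro lborel_integral_eq_integral_cbox(2)[symmetric] cs) auto
    also have "\<dots> = (LINT x|distr lborel borel (?\<Phi> s). F x)"
      by (rule integral_distr[symmetric])
         (auto intro!: borel_measurable_continuous_onI continuous_intros c(1))
    finally show ?thesis by (simp add: lborel_distr_hmul_right)
  qed
  have "((\<lambda>s. integral (cbox l u) (\<lambda>x. F (?\<Phi> s x))) has_field_derivative
      integral (cbox l u) (\<lambda>x. F' (?\<Phi> 0 x))) (at 0 within {-1<..<1})"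
  proof (rule leibniz_rule_field_derivative[where f = "\<lambda>s x. F (?\<Phi> s x)" and fx = "\<lambda>s x. F' (?\<Phi> s x)"])
    show "((\<lambda>s. F (?\<Phi> s x)) has_field_derivative F' (?\<Phi> s x)) (at s within {-1<..<1})" for s x
      by (rule has_field_derivative_at_within[OF flow_deriv_at[OF d]])
    show "(\<lambda>x. F (?\<Phi> s x)) integrable_on cbox l u" for s
      by (intro integrable_continuous continuous_on_subset[OF cs]) auto
    show "continuous_on ({-1<..<1} \<times> cbox l u) (\<lambda>(s, x). F' (?\<Phi> s x))"
      unfolding case_prod_beta'
      by (intro continuous_on_compose2[OF c(2)] continuous_intros) auto
  qed auto
  then have "((\<lambda>s. integral (cbox l u) (\<lambda>x. F (?\<Phi> s x))) has_field_derivative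
      integral (cbox l u) F') (at 0 within {-1<..<1})"
    by (simp add: hmul_zero zero_prod_def[symmetric])
  then have "((\<lambda>s. LINT x|lborel. F x) has_field_derivative integral (cbox l u) F') (at 0 within {-1<..<1})"
    by (rule has_field_derivative_transform_within[where d = 1]) (simp, simp, rule const)
  then have "((\<lambda>s. LINT x|lborel. F x) has_field_derivative integral (cbox l u) F') (at 0)"
    by (subst (asm) at_within_open) auto
  then have "integral (cbox l u) F' = 0"
    by (rule DERIV_unique) (rule DERIV_const)
  then show ?thesis
    using lborel_integral_eq_integral_cbox(2)[OF c(2) F'0] by simp
qed

text \<open>\<open>F2 * G - F * G2\<close> is the flow derivative of \<open>F1 * G - F * G1\<close>,
  which is compactly supported because \<open>G\<close> and \<open>G1\<close> are.\<close>

lemma integral_flow_by_parts: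
  fixes F G :: "'n::finite heis \<Rightarrow> real"
  assumes F: "flow_deriv a F F1" "flow_deriv a F1 F2"
    and G: "flow_deriv a G G1" "flow_deriv a G1 G2"
    and cF: "continuous_on UNIV F" "continuous_on UNIV F1" "continuous_on UNIV F2"
    and cG: "continuous_on UNIV G" "continuous_on UNIV G1" "continuous_on UNIV G2"
    and S: "bounded S" "\<And>x. x \<notin> S \<Longrightarrow> G x = 0 \<and> G1 x = 0 \<and> G2 x = 0"
  shows "(LINT x|lborel. F2 x * G x) = (LINT x|lborel. F x * G2 x)"
proof -
  obtain l u where lu: "S \<subseteq> cbox l u"
    using bounded_subset_cbox_symmetric[OF S(1)] by metis
  then have "G x = 0 \<and> G2 x = 0" if "x \<notin> cbox l u" for x
    using S(2)[of x] that by auto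
  then have "integrable lborel (\<lambda>x. F2 x * G x)" "integrable lborel (\<lambda>x. F x * G2 x)"
    by (intro lborel_integral_eq_integral_cbox(1)[of _ l u] continuous_on_mult cF cG; simp)+
  moreover have "(LINT x|lborel. (F2 x * G x + F1 x * G1 x) - (F1 x * G1 x + F x * G2 x)) = 0"
  proof (rule integral_flow_deriv_eq_0)
    show "flow_deriv a (\<lambda>x. F1 x * G x - F x * G1 x)
        (\<lambda>x. (F2 x * G x + F1 x * G1 x) - (F1 x * G1 x + F x * G2 x))"
      by (intro flow_deriv_diff flow_deriv_mult F G)
  qed (use S in \<open>auto intro!: continuous_intros cF cG\<close>)
  ultimately show ?thesis by simp
qed

section \<open>The heat kernel and the gauge\<close>

lemma heat_kernel_C_class:
  assumes "heat_kernel p" "t > 0"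
  shows "C_class 2 UNIV (p t)"
  using assms C_class_slice[of 2 "\<lambda>(t, x). p t x" t] by (simp add: heat_kernel_def smooth_on_def)

lemma heat_kernel_integral:
  assumes "heat_kernel p" "t > 0"
  shows "integrable lborel (p t)" "(LINT x|lborel. p t x) = 1"
  using assms by (auto simp: heat_kernel_def has_bochner_integral_iff)

lemma heat_kernel_pos: "heat_kernel p \<Longrightarrow> t > 0 \<Longrightarrow> 0 < p t x"
  unfolding heat_kernel_def by blast

lemma heat_kernel_continuous:
  assumes "heat_kernel p" "t > 0"
  shows "continuous_on UNIV (p t)"
  using heat_kernel_C_class[OF assms] by (rule C_class_imp_continuous)

text \<open>By the heat equation the sub-Laplacian is a time derivative, hence a first-order partial
  derivative of a jointly smooth function. Joint continuity allows differentiation in time under the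
  integral.\<close>

lemma continuous_sublaplacian_heat_kernel:
  fixes p :: "real \<Rightarrow> 'n::finite heis \<Rightarrow> real"
  assumes p: "heat_kernel p"
  shows "continuous_on ({0<..} \<times> UNIV) (\<lambda>(t, x). sublaplacian (p t) x)"
proof -
  let ?P = "\<lambda>(t, x). p t x"
  have "C_class (Suc 0) ({0<..} \<times> UNIV) ?P"
    using p by (simp add: heat_kernel_def smooth_on_def del: C_class.simps)
  moreover have "(1, 0) \<in> (Basis :: (real \<times> 'n heis) set)"
    by (simp add: Basis_prod_def)
  ultimately have "continuous_on ({0<..} \<times> UNIV) (dirderiv (1, 0) ?P)"
    by (simp del: case_prod_conv)
  moreover have "dirderiv (1, 0) ?P z = (\<lambda>(t, x). sublaplacian (p t) x) z" if "z \<in> {0<..} \<times> UNIV" for z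
  proof -
    obtain t x where z: "z = (t, x)" by (cases z)
    then have "((\<lambda>s. p s x) has_real_derivative sublaplacian (p t) x) (at (0 + t))"
      using p that by (auto simp: heat_kernel_def)
    then have "((\<lambda>s. p (t + s) x) has_real_derivative sublaplacian (p t) x) (at 0)"
      by (subst (asm) DERIV_shift) (simp add: add.commute)
    then show ?thesis
      by (simp add: z dirderiv_def DERIV_imp_deriv)
  qed
  ultimately show ?thesis by (simp cong: continuous_on_cong)
qed

text \<open>
  No decay of the derivatives of the kernel is known, so the second-order operator is moved onto a
  compactly supported function; the monotonicity in \<open>s\<close> starts from the Dirac condition at \<open>s = 0\<close>.
\<close>

lemma heat_kernel_test:
  fixes p :: "real \<Rightarrow> 'n::finite heis \<Rightarrow> real"
  assumes p: "heat_kernel p"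
    and G: "\<And>i b. b \<in> {1, \<i>} \<Longrightarrow> flow_deriv (axis i b) G (G1 i b)"
      "\<And>i b. b \<in> {1, \<i>} \<Longrightarrow> flow_deriv (axis i b) (G1 i b) (G2 i b)"
    and cG: "continuous_on UNIV G" "\<And>i b. continuous_on UNIV (G1 i b)" "\<And>i b. continuous_on UNIV (G2 i b)"
    and S: "bounded S" "\<And>x i b. x \<notin> S \<Longrightarrow> G x = 0 \<and> G1 i b x = 0 \<and> G2 i b x = 0"
    and K: "\<And>x. (\<Sum>i\<in>UNIV. G2 i 1 x + G2 i \<i> x) \<ge> - K"
    and "s > 0"
  shows "(LINT z|lborel. p s z * G z) \<ge> G 0 - K * s"
proof -
  obtain l u where lu: "S \<subseteq> cbox l u"
    using bounded_subset_cbox_symmetric[OF S(1)] by metis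
  then have z: "G x = 0" "G2 i b x = 0" if "x \<notin> cbox l u" for x i b
    using S(2)[of x] that by auto
  define I where "I = (\<lambda>t. LINT z|lborel. p t z * G z)"
  have I_eq: "I t = integral (cbox l u) (\<lambda>z. p t z * G z)" if "t > 0" for t
    unfolding I_def using z(1) that
    by (intro lborel_integral_eq_integral_cbox(2) continuous_on_mult cG heat_kernel_continuous[OF p]) auto
  have csl: "continuous_on UNIV (sublaplacian (p t))" if "t > 0" for t
    by (rule continuous_on_compose2[OF continuous_sublaplacian_heat_kernel[OF p], of UNIV "\<lambda>x. (t, x)", simplified])
       (use that in \<open>auto intro!: continuous_intros\<close>)
  have DI: "(I has_real_derivative integral (cbox l u) (\<lambda>z. sublaplacian (p t) z * G z)) (at t)"
    if t: "t > 0" for t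
  proof -
    have "((\<lambda>t. integral (cbox l u) (\<lambda>z. p t z * G z)) has_field_derivative
        integral (cbox l u) (\<lambda>z. sublaplacian (p t) z * G z)) (at t within {0<..})"
    proof (rule leibniz_rule_field_derivative[where f = "\<lambda>t z. p t z * G z"
            and fx = "\<lambda>t z. sublaplacian (p t) z * G z"])
      fix t z assume t: "t \<in> {0::real<..}"
      have "((\<lambda>s. p s z) has_real_derivative sublaplacian (p t) z) (at t)"
        using p t by (simp add: heat_kernel_def)
      then show "((\<lambda>s. p s z * G z) has_field_derivative sublaplacian (p t) z * G z) (at t within {0<..})"
        by (intro has_field_derivative_at_within[OF DERIV_cmult_right])
    next
      fix t :: real assume "t \<in> {0<..}"
      then show "(\<lambda>z. p t z * G z) integrable_on cbox l u"
        by (intro integrable_continuous continuous_on_mult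
              continuous_on_subset[OF heat_kernel_continuous[OF p]] continuous_on_subset[OF cG(1)]) auto
    next
      have "continuous_on ({0<..} \<times> cbox l u) (\<lambda>(t, z). sublaplacian (p t) z)"
        by (rule continuous_on_subset[OF continuous_sublaplacian_heat_kernel[OF p]]) auto
      moreover have "continuous_on ({0::real<..} \<times> cbox l u) (\<lambda>z. G (snd z))"
        by (intro continuous_on_compose2[OF cG(1)] continuous_intros) auto
      ultimately show "continuous_on ({0<..} \<times> cbox l u) (\<lambda>(t, z). sublaplacian (p t) z * G z)"
        unfolding case_prod_beta' by (rule continuous_on_mult)
    qed (use t in auto)
    then have "(I has_field_derivative
        integral (cbox l u) (\<lambda>z. sublaplacian (p t) z * G z)) (at t within {0<..})"
      by (rule has_field_derivative_transform_within[where d = 1]) (use t in \<open>simp_all add: I_eq\<close>)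
    then show ?thesis
      using t by (subst (asm) at_within_open) auto
  qed
  have lower: "integral (cbox l u) (\<lambda>z. sublaplacian (p t) z * G z) \<ge> - K" if t: "t > 0" for t
  proof -
    let ?a = "\<lambda>i b. axis i b :: complex ^ 'n"
    let ?H = "\<lambda>i b. hfield (?a i b) (hfield (?a i b) (p t))"
    have q: "C_class 2 UNIV (p t)" by (rule heat_kernel_C_class[OF p t])
    note ch = C_class_hfield[OF q]
    have part: "(LINT z|lborel. ?H i b z * G z) = (LINT z|lborel. p t z * G2 i b z)"
      if b: "b \<in> {1, \<i>}" for i b
      by (rule integral_flow_by_parts[OF ch(1)[OF b] ch(2)[OF b] G(1)[OF b] G(2)[OF b]
            C_class_imp_continuous[OF q] ch(3)[OF b] ch(4)[OF b] cG(1) cG(2) cG(3) S])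
    have i1: "integrable lborel (\<lambda>z. ?H i b z * G z)" if b: "b \<in> {1, \<i>}" for i b
      by (rule lborel_integral_eq_integral_cbox(1)[of _ l u])
         (auto intro!: continuous_on_mult ch(4)[OF b] cG simp: z)
    have i2: "integrable lborel (\<lambda>z. p t z * G2 i b z)" for i b
      by (rule lborel_integral_eq_integral_cbox(1)[of _ l u])
         (auto intro!: continuous_on_mult C_class_imp_continuous[OF q] cG simp: z)
    have "integral (cbox l u) (\<lambda>z. sublaplacian (p t) z * G z)
        = (LINT z|lborel. sublaplacian (p t) z * G z)"
      by (intro lborel_integral_eq_integral_cbox(2)[symmetric] continuous_on_mult csl[OF t] cG) (simp add: z)
    also have "\<dots> = (LINT z|lborel. (\<Sum>i\<in>UNIV. ?H i 1 z * G z + ?H i \<i> z * G z))"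
      by (simp add: sublaplacian_def vfX_eq vfY_eq sum_distrib_right distrib_right)
    also have "\<dots> = (\<Sum>i\<in>UNIV. (LINT z|lborel. ?H i 1 z * G z) + (LINT z|lborel. ?H i \<i> z * G z))"
      by (simp add: i1 del: distrib_right_numeral)
    also have "\<dots> = (\<Sum>i\<in>UNIV. (LINT z|lborel. p t z * G2 i 1 z) + (LINT z|lborel. p t z * G2 i \<i> z))"
      by (simp add: part)
    also have "\<dots> = (LINT z|lborel. (\<Sum>i\<in>UNIV. p t z * G2 i 1 z + p t z * G2 i \<i> z))"
      by (simp add: i2)
    \<comment> \<open>Positivity of the kernel carries the pointwise bound under the integral, and
      total mass one leaves exactly \<open>- K\<close>.\<close>
    also have "\<dots> \<ge> (LINT z|lborel. p t z * (- K))"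
    proof (rule integral_mono)
      show "integrable lborel (\<lambda>z. p t z * - K)"
        using heat_kernel_integral(1)[OF p t] by simp
      show "integrable lborel (\<lambda>z. \<Sum>i\<in>UNIV. p t z * G2 i 1 z + p t z * G2 i \<i> z)"
        by (intro Bochner_Integration.integrable_sum Bochner_Integration.integrable_add i2)
      show "p t z * - K \<le> (\<Sum>i\<in>UNIV. p t z * G2 i 1 z + p t z * G2 i \<i> z)" for z
      proof -
        have "0 \<le> p t z" using p t by (simp add: heat_kernel_def less_imp_le)
        then have "p t z * - K \<le> p t z * (\<Sum>i\<in>UNIV. G2 i 1 z + G2 i \<i> z)"
          using K by (rule mult_left_mono[rotated])
        then show ?thesis by (simp add: sum_distrib_left distrib_left)
      qed
    qed
    finally show ?thesis
      using heat_kernel_integral[OF p t] by simp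
  qed
  have mono: "I r + K * r \<le> I s + K * s" if "0 < r" "r \<le> s" for r
  proof (rule DERIV_nonneg_imp_nondecreasing[OF that(2)])
    fix x assume "r \<le> x" "x \<le> s"
    with that have x: "0 < x" by simp
    show "\<exists>y. ((\<lambda>r. I r + K * r) has_real_derivative y) (at x) \<and> 0 \<le> y"
      using lower[OF x]
      by (intro exI[of _ "integral (cbox l u) (\<lambda>z. sublaplacian (p x) z * G z) + K"] conjI)
         (auto intro!: derivative_eq_intros DI x)
  qed
  have "G \<in> C0"
  proof -
    obtain B where B: "\<And>x. x \<in> S \<Longrightarrow> norm x \<le> B" using S(1) by (auto simp: bounded_iff)
    have "\<forall>\<^sub>F x in at_infinity. G x = 0"
      unfolding eventually_at_infinity using S(2) B by (intro exI[of _ "B + 1"]) force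
    then show ?thesis by (simp add: C0_def cG tendsto_eventually)
  qed
  then have "(I \<longlongrightarrow> G 0) (at_right 0)"
    using p by (simp add: heat_kernel_def I_def)
  then have "((\<lambda>r. I r + K * r) \<longlongrightarrow> G 0 + K * 0) (at_right 0)"
    by (intro tendsto_intros)
  moreover have "\<forall>\<^sub>F r in at_right 0. I r + K * r \<le> I s + K * s"
    using eventually_at_right_real[OF \<open>s > 0\<close>] by eventually_elim (auto intro: mono)
  ultimately have "G 0 + K * 0 \<le> I s + K * s"
    by (rule tendsto_upperbound) simp
  then show ?thesis by (simp add: I_def)
qed

section \<open>The gauge and its horizontal derivatives\<close>

text \<open>The square of the homogeneous norm, regularized by the 1 under the root, which removes
  the singularity at the identity. Its degree two under dilations matches that of time.\<close>

definition hgauge :: "'n::finite heis \<Rightarrow> real" where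
  "hgauge x = sqrt (1 + ((norm (fst x))\<^sup>2)\<^sup>2 + (snd x)\<^sup>2)"

lemma hgauge_ge: "norm (fst x) ^ 2 \<le> hgauge x" "\<bar>snd x\<bar> \<le> hgauge x" "1 \<le> hgauge x"
  by (auto simp: hgauge_def intro!: real_le_rsqrt)

lemma hgauge_pos: "0 < hgauge x"
  using hgauge_ge(3)[of x] by linarith

lemma continuous_on_hgauge [continuous_intros]:
  "continuous_on S f \<Longrightarrow> continuous_on S (\<lambda>x. hgauge (f x))"
  unfolding hgauge_def by (intro continuous_intros)

lemma bounded_hgauge: "bounded {x. hgauge x \<le> R}"
proof -
  have "norm x \<le> 1 + 2 * R" if "hgauge x \<le> R" for x :: "'n::finite heis"
  proof -
    have "norm x \<le> norm (fst x) + norm (snd x)"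
      using norm_Pair_le[of "fst x" "snd x"] by simp
    moreover have "norm (fst x) \<le> 1 + (norm (fst x))\<^sup>2"
      using zero_le_power2[of "norm (fst x) - 1"] norm_ge_zero[of "fst x"]
      unfolding power2_diff power_one by linarith
    ultimately show ?thesis
      using hgauge_ge(1,2)[of x] that by simp
  qed
  then show ?thesis unfolding bounded_iff by blast
qed

lemma bounded_hgauge_translate: "bounded {z. hgauge (hmul y z) \<le> R}"
proof -
  have "compact (hmul (hinv y) ` closure {x. hgauge x \<le> R})"
    using bounded_hgauge by (intro compact_continuous_image continuous_intros) auto
  moreover have "{z. hgauge (hmul y z) \<le> R} \<subseteq> hmul (hinv y) ` closure {x. hgauge x \<le> R}"
  proof
    fix z assume "z \<in> {z. hgauge (hmul y z) \<le> R}"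
    then have "hmul y z \<in> closure {x. hgauge x \<le> R}"
      by (intro subsetD[OF closure_subset]) simp
    moreover have "z = hmul (hinv y) (hmul y z)"
      by (simp add: hmul_assoc[symmetric] hmul_hinv hmul_zero)
    ultimately show "z \<in> hmul (hinv y) ` closure {x. hgauge x \<le> R}"
      by (rule rev_image_eqI)
  qed
  ultimately show ?thesis
    by (meson bounded_subset compact_imp_bounded)
qed

text \<open>The derivative of the squared gauge \<open>R0\<close> is \<open>2 * h\<close>, so the
  first formula is the chain rule for the root; the second is the product rule for \<open>h\<close>
  and the inverse gauge. The negative square is kept as a separate term because an upper bound
  simply drops it.\<close>

lemma flow_deriv_hgauge:
  fixes i :: "'n::finite" and b :: complex
  assumes b: "norm b = 1"
  defines "a \<equiv> axis i b"
  defines "h \<equiv> \<lambda>x. 2 * (norm (fst x))\<^sup>2 * (fst x $ i \<bullet> b) + snd x * twist a x"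
  shows "flow_deriv a hgauge (\<lambda>x. h x / hgauge x)"
    and "flow_deriv a (\<lambda>x. h x / hgauge x) (\<lambda>x. (4 * (fst x $ i \<bullet> b)\<^sup>2 + 2 * (norm (fst x))\<^sup>2 + (twist a x)\<^sup>2) / hgauge x
           - (h x)\<^sup>2 / hgauge x ^ 3)"
proof -
  have bb: "b \<bullet> b = 1" using b by (simp add: dot_square_norm)
  have flow_const: "flow_deriv a (\<lambda>_. c) (\<lambda>_. 0)" for c
    by (simp add: flow_deriv_def)
  have \<alpha>: "flow_deriv a (\<lambda>x. fst x $ i \<bullet> b) (\<lambda>_. 1)"
    unfolding flow_deriv_def hmul_flow
    by (auto intro!: derivative_eq_intros simp: a_def inner_add_left bb)
  have A: "flow_deriv a (\<lambda>x. (norm (fst x))\<^sup>2) (\<lambda>x. 2 * (fst x $ i \<bullet> b))"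
  proof -
    have "(norm (fst (x + s *\<^sub>R (a, c))))\<^sup>2 = (norm (fst x))\<^sup>2 + 2 * s * (fst x $ i \<bullet> b) + s\<^sup>2" for x :: "'n heis" and s c
      unfolding power2_norm_eq_inner
      by (simp add: a_def inner_add_left inner_add_right inner_axis inner_axis' bb power2_eq_square inner_commute)
    then show ?thesis
      unfolding flow_deriv_def hmul_flow by (auto intro!: derivative_eq_intros)
  qed
  have Z: "flow_deriv a snd (twist a)"
    unfolding flow_deriv_def hmul_flow by (auto intro!: derivative_eq_intros)
  define R0 where "R0 = (\<lambda>x::'n heis. 1 + (norm (fst x))\<^sup>2 * (norm (fst x))\<^sup>2 + snd x * snd x)"
  have R0: "hgauge = (\<lambda>x. sqrt (R0 x))" "\<And>x. R0 x > 0"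
    unfolding R0_def
    by (simp add: hgauge_def[abs_def] power2_eq_square) (intro add_pos_nonneg, simp_all)
  have "flow_deriv a R0 (\<lambda>x. 0 + (2 * (fst x $ i \<bullet> b) * (norm (fst x))\<^sup>2 + (norm (fst x))\<^sup>2 * (2 * (fst x $ i \<bullet> b)))
      + (twist a x * snd x + snd x * twist a x))"
    unfolding R0_def by (intro flow_deriv_add flow_deriv_mult flow_const A Z)
  then have R1: "flow_deriv a R0 (\<lambda>x. 2 * h x)"
    by (simp add: h_def algebra_simps)
  have "flow_deriv a (\<lambda>x. sqrt (R0 x)) (\<lambda>x. inverse (sqrt (R0 x)) / 2 * (2 * h x))"
    by (rule flow_deriv_compose[OF R1]) (rule DERIV_real_sqrt[OF R0(2)])
  then show 1: "flow_deriv a hgauge (\<lambda>x. h x / hgauge x)"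
    by (simp add: R0(1) field_simps)
  have h1: "flow_deriv a h (\<lambda>x. (2 * (2 * (fst x $ i \<bullet> b))) * (fst x $ i \<bullet> b) + 2 * (norm (fst x))\<^sup>2 * 1
      + (twist a x * twist a x + snd x * 0))"
  proof -
    have "flow_deriv a (\<lambda>x. 2 * (norm (fst x))\<^sup>2) (\<lambda>x. 2 * (2 * (fst x $ i \<bullet> b)))"
      using flow_deriv_mult[OF flow_const[of 2] A] by simp
    then show ?thesis
      unfolding h_def by (intro flow_deriv_add flow_deriv_mult Z \<alpha> flow_deriv_twist)
  qed
  have "flow_deriv a (\<lambda>x. inverse (hgauge x)) (\<lambda>x. - (inverse (hgauge x) ^ Suc (Suc 0)) * (h x / hgauge x))"
    by (rule flow_deriv_compose[OF 1]) (rule DERIV_inverse, rule hgauge_pos[THEN less_imp_neq, THEN not_sym])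
  from flow_deriv_mult[OF h1 this]
  show "flow_deriv a (\<lambda>x. h x / hgauge x) (\<lambda>x. (4 * (fst x $ i \<bullet> b)\<^sup>2 + 2 * (norm (fst x))\<^sup>2 + (twist a x)\<^sup>2) / hgauge x
           - (h x)\<^sup>2 / hgauge x ^ 3)"
    by (simp add: divide_inverse power2_eq_square power3_eq_cube power_inverse algebra_simps)
qed

section \<open>A twice continuously differentiable regularization of the positive part\<close>

lemma DERIV_quadratic_bound:
  fixes f :: "real \<Rightarrow> real"
  assumes "\<And>x. \<bar>f x\<bar> \<le> C * x\<^sup>2"
  shows "(f has_real_derivative 0) (at 0)"
proof -
  have "f 0 = 0" using assms[of 0] by simp
  moreover have "((\<lambda>h. f h / h) \<longlongrightarrow> 0) (at 0)"
  proof (rule Lim_null_comparison)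
    show "\<forall>\<^sub>F h in at 0. norm (f h / h) \<le> C * \<bar>h\<bar>"
      using assms by (intro always_eventually) (auto simp: abs_divide divide_le_eq power2_eq_square mult.assoc)
    show "((\<lambda>h. C * \<bar>h\<bar>) \<longlongrightarrow> 0) (at 0)"
      by (auto intro!: tendsto_eq_intros)
  qed
  ultimately show ?thesis by (simp add: has_field_derivative_iff)
qed

text \<open>Only the point 0 needs an argument, and there the quadratic bound makes the derivative
  vanish from both sides. It is applied to the regularization and again to its first
  derivative.\<close>

lemma DERIV_positive_part_compose:
  fixes g :: "real \<Rightarrow> real"
  assumes g: "\<And>x. x > 0 \<Longrightarrow> (g has_real_derivative g' x) (at x)"
    and "g 0 = 0" "g' 0 = 0" and C: "\<And>x. x \<ge> 0 \<Longrightarrow> \<bar>g x\<bar> \<le> C * x\<^sup>2"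
  shows "((\<lambda>x. g (max 0 x)) has_real_derivative g' (max 0 x)) (at x)"
proof (cases x "0::real" rule: linorder_cases)
  case less
  have "((\<lambda>x. 0) has_real_derivative 0) (at x)" by simp
  then have "((\<lambda>x. g (max 0 x)) has_real_derivative 0) (at x)"
    by (rule has_field_derivative_transform_within_open[where S = "{..<0}"]) (use less assms in auto)
  then show ?thesis using less assms by simp
next
  case greater
  from g[OF this] have "((\<lambda>x. g (max 0 x)) has_real_derivative g' x) (at x)"
    by (rule has_field_derivative_transform_within_open[where S = "{0<..}"]) (use greater in auto)
  then show ?thesis using greater by simp
next
  case equal
  have "0 \<le> C" using C[of 1] by simp
  then have "\<bar>g (max 0 x)\<bar> \<le> C * x\<^sup>2" for x
    using C[of x] C[of 0] assms(2) by (cases "x \<ge> 0") auto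
  from DERIV_quadratic_bound[of "\<lambda>x. g (max 0 x)", OF this] show ?thesis
    using equal assms by simp
qed

text \<open>
  For \<open>m = max 0 x\<close>, the function \<open>m\<^sup>3 / (m + \<epsilon>)\<^sup>2\<close> is a \<open>C\<^sup>2\<close> convex minorant of \<open>m\<close> with slope at most 1.
\<close>

context
  fixes \<epsilon> :: real
  assumes \<epsilon>: "\<epsilon> > 0"
begin

lemma DERIV_soft_plus1:
  "((\<lambda>x. max 0 x ^ 3 / (max 0 x + \<epsilon>)\<^sup>2) has_real_derivative
     max 0 x ^ 2 * (max 0 x + 3 * \<epsilon>) / (max 0 x + \<epsilon>) ^ 3) (at x)"
proof (rule DERIV_positive_part_compose[where C = "1 / \<epsilon>"])
  fix x :: real assume x: "x > 0"
  \<comment> \<open>In terms of \<open>y\<close> all denominators are powers of one variable, and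
    the two forms of the derivative differ by a polynomial identity.\<close>
  define y where "y = x + \<epsilon>"
  have y: "y > 0" "\<epsilon> = y - x" using x \<epsilon> by (auto simp: y_def)
  have "((\<lambda>x. x ^ 3 / (x + \<epsilon>)\<^sup>2) has_real_derivative
      (3 * x ^ 2 * (x + \<epsilon>)\<^sup>2 - x ^ 3 * (2 * (x + \<epsilon>))) / ((x + \<epsilon>)\<^sup>2 * (x + \<epsilon>)\<^sup>2)) (at x)"
    using x \<epsilon> by (auto intro!: derivative_eq_intros)
  moreover have "(3 * x ^ 2 * y\<^sup>2 - x ^ 3 * (2 * y)) / (y\<^sup>2 * y\<^sup>2) = x ^ 2 * (x + 3 * (y - x)) / y ^ 3"
    using y(1) by (simp add: divide_simps) (simp add: eval_nat_numeral algebra_simps)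
  ultimately show "((\<lambda>x. x ^ 3 / (x + \<epsilon>)\<^sup>2) has_real_derivative x ^ 2 * (x + 3 * \<epsilon>) / (x + \<epsilon>) ^ 3) (at x)"
    unfolding y(2)[symmetric] y_def by simp
next
  fix x :: real assume x: "x \<ge> 0"
  have "x ^ 3 * \<epsilon> \<le> x\<^sup>2 * (x + \<epsilon>)\<^sup>2"
  proof -
    have "x\<^sup>2 * (x * \<epsilon>) \<le> x\<^sup>2 * (x + \<epsilon>)\<^sup>2"
      using x \<epsilon> by (intro mult_left_mono) (auto simp: power2_eq_square algebra_simps)
    then show ?thesis by (simp add: power2_eq_square power3_eq_cube)
  qed
  then show "\<bar>x ^ 3 / (x + \<epsilon>)\<^sup>2\<bar> \<le> 1 / \<epsilon> * x\<^sup>2"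
    using x \<epsilon> by (simp add: divide_simps mult.commute)
qed (use \<epsilon> in auto)

lemma DERIV_soft_plus2:
  "((\<lambda>x. max 0 x ^ 2 * (max 0 x + 3 * \<epsilon>) / (max 0 x + \<epsilon>) ^ 3) has_real_derivative
     6 * \<epsilon>\<^sup>2 * max 0 x / (max 0 x + \<epsilon>) ^ 4) (at x)"
proof (rule DERIV_positive_part_compose[where C = "3 / \<epsilon>\<^sup>2"])
  fix x :: real assume x: "x > 0"
  define y where "y = x + \<epsilon>"
  have y: "y > 0" "\<epsilon> = y - x" using x \<epsilon> by (auto simp: y_def)
  have "((\<lambda>x. x ^ 2 * (x + 3 * \<epsilon>) / (x + \<epsilon>) ^ 3) has_real_derivative
      ((2 * x * (x + 3 * \<epsilon>) + x\<^sup>2) * (x + \<epsilon>) ^ 3 - x ^ 2 * (x + 3 * \<epsilon>) * (3 * (x + \<epsilon>)\<^sup>2)) / ((x + \<epsilon>) ^ 3 * (x + \<epsilon>) ^ 3)) (at x)"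
    using x \<epsilon> by (auto intro!: derivative_eq_intros)
  moreover have "((2 * x * (x + 3 * (y - x)) + x\<^sup>2) * y ^ 3 - x ^ 2 * (x + 3 * (y - x)) * (3 * y\<^sup>2)) / (y ^ 3 * y ^ 3)
      = 6 * (y - x)\<^sup>2 * x / y ^ 4"
    using y(1) by (simp add: divide_simps) (simp add: eval_nat_numeral algebra_simps)
  ultimately show "((\<lambda>x. x ^ 2 * (x + 3 * \<epsilon>) / (x + \<epsilon>) ^ 3) has_real_derivative 6 * \<epsilon>\<^sup>2 * x / (x + \<epsilon>) ^ 4) (at x)"
    unfolding y(2)[symmetric] y_def by simp
next
  fix x :: real assume x: "x \<ge> 0"
  have "x ^ 2 * (x + 3 * \<epsilon>) / (x + \<epsilon>) ^ 3 \<le> x ^ 2 * (3 * (x + \<epsilon>)) / (x + \<epsilon>) ^ 3"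
    using x \<epsilon> by (intro divide_right_mono mult_left_mono) auto
  also have "\<dots> = 3 * x\<^sup>2 / (x + \<epsilon>)\<^sup>2"
    using x \<epsilon> by (simp add: divide_simps) (simp add: power2_eq_square power3_eq_cube)
  also have "\<dots> \<le> 3 * x\<^sup>2 / \<epsilon>\<^sup>2"
    using x \<epsilon> by (intro divide_left_mono power_mono) auto
  finally show "\<bar>x ^ 2 * (x + 3 * \<epsilon>) / (x + \<epsilon>) ^ 3\<bar> \<le> 3 / \<epsilon>\<^sup>2 * x\<^sup>2"
    using x \<epsilon> by simp
qed (use \<epsilon> in auto)

text \<open>The gap \<open>2 * \<epsilon>\<close> is the one seen at infinity, where
  \<open>m ^ 3 / (m + \<epsilon>) ^ 2\<close> behaves like \<open>m - 2 * \<epsilon>\<close>. Each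
  bound becomes a polynomial inequality after clearing denominators.\<close>

lemma soft_plus_bounds:
  fixes x :: real
  shows "max 0 x - 2 * \<epsilon> \<le> max 0 x ^ 3 / (max 0 x + \<epsilon>)\<^sup>2"
    and "max 0 x ^ 3 / (max 0 x + \<epsilon>)\<^sup>2 \<le> max 0 x"
    and "max 0 x ^ 2 * (max 0 x + 3 * \<epsilon>) / (max 0 x + \<epsilon>) ^ 3 \<le> 1"
proof -
  define m where "m = max 0 x"
  have m: "m \<ge> 0" by (simp add: m_def)
  have pos: "(m + \<epsilon>)\<^sup>2 > 0" "(m + \<epsilon>) ^ 3 > 0" using m \<epsilon> by auto
  have "(m - 2 * \<epsilon>) * (m + \<epsilon>)\<^sup>2 = m ^ 3 - 3 * \<epsilon>\<^sup>2 * m - 2 * \<epsilon> ^ 3"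
    by (simp add: power2_eq_square power3_eq_cube algebra_simps)
  also have "\<dots> \<le> m ^ 3"
  proof -
    have "0 \<le> 3 * \<epsilon>\<^sup>2 * m" "0 \<le> 2 * \<epsilon> ^ 3" using m \<epsilon> by simp_all
    then show ?thesis by linarith
  qed
  finally show "max 0 x - 2 * \<epsilon> \<le> max 0 x ^ 3 / (max 0 x + \<epsilon>)\<^sup>2"
    unfolding m_def[symmetric] using pos by (simp add: pos_le_divide_eq)
  have "m ^ 3 \<le> m * (m + \<epsilon>)\<^sup>2"
    unfolding power3_eq_cube mult.assoc power2_eq_square
    using m \<epsilon> by (intro mult_left_mono mult_mono) auto
  then show "max 0 x ^ 3 / (max 0 x + \<epsilon>)\<^sup>2 \<le> max 0 x"
    unfolding m_def[symmetric] using pos by (simp add: pos_divide_le_eq)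
  have "(m + \<epsilon>) ^ 3 = m ^ 2 * (m + 3 * \<epsilon>) + (3 * \<epsilon>\<^sup>2 * m + \<epsilon> ^ 3)"
    by (simp add: power2_eq_square power3_eq_cube algebra_simps)
  then have "m ^ 2 * (m + 3 * \<epsilon>) \<le> (m + \<epsilon>) ^ 3"
    using m \<epsilon> by simp
  then show "max 0 x ^ 2 * (max 0 x + 3 * \<epsilon>) / (max 0 x + \<epsilon>) ^ 3 \<le> 1"
    unfolding m_def[symmetric] using pos by (simp add: pos_divide_le_eq)
qed

end

text \<open>Left translation by \<open>y\<close> puts the starting point of the flow at the
  identity, where the Dirac condition lives. For the regularized weight, the sub-Laplacian is a term
  with \<open>\<eta>2\<close>, nonnegative by convexity, minus \<open>\<eta>1 / R\<close> times the
  sub-Laplacian of the gauge. Since \<open>\<eta>1\<close> lies between 0 and 1, an upper bound for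
  the latter is all that is needed.\<close>

lemma heat_kernel_hgauge:
  fixes p :: "real \<Rightarrow> 'n::finite heis \<Rightarrow> real"
  assumes p: "heat_kernel p" and s: "s > 0" and R: "R > 0"
  shows "(LINT z|lborel. p s z * max 0 (1 - hgauge (hmul y z) / R))
      \<ge> max 0 (1 - hgauge y / R) - (8 + 4 * CARD('n)) / R * s"
proof (rule field_le_epsilon)
  fix e :: real assume "e > 0"
  \<comment> \<open>The regularization loses at most \<open>2 * \<epsilon>\<close>, hence at most
    \<open>e\<close>.\<close>
  define \<epsilon> where "\<epsilon> = e / 2"
  have \<epsilon>: "\<epsilon> > 0" using \<open>e > 0\<close> by (simp add: \<epsilon>_def)
  define K where "K = (8 + 4 * real CARD('n)) / R"
  define \<eta> \<eta>1 \<eta>2 :: "real \<Rightarrow> real" where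
    "\<eta> = (\<lambda>x. max 0 x ^ 3 / (max 0 x + \<epsilon>)\<^sup>2)"
    "\<eta>1 = (\<lambda>x. max 0 x ^ 2 * (max 0 x + 3 * \<epsilon>) / (max 0 x + \<epsilon>) ^ 3)"
    "\<eta>2 = (\<lambda>x. 6 * \<epsilon>\<^sup>2 * max 0 x / (max 0 x + \<epsilon>) ^ 4)"
  note \<eta>_defs = this
  have D\<eta>: "(\<eta> has_real_derivative \<eta>1 x) (at x)" "(\<eta>1 has_real_derivative \<eta>2 x) (at x)" for x
    unfolding \<eta>_defs by (rule DERIV_soft_plus1[OF \<epsilon>] DERIV_soft_plus2[OF \<epsilon>])+
  have ne: "max 0 x + \<epsilon> \<noteq> 0" for x using \<epsilon> by (simp add: max_def)
  have c\<eta>: "continuous_on UNIV \<eta>" "continuous_on UNIV \<eta>1" "continuous_on UNIV \<eta>2"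
    unfolding \<eta>_defs by (intro continuous_intros; simp add: ne)+
  have \<eta>1_bound: "0 \<le> \<eta>1 x" "\<eta>1 x \<le> 1" and \<eta>2_pos: "0 \<le> \<eta>2 x" for x
    using \<epsilon> soft_plus_bounds(3)[OF \<epsilon>] by (auto simp: \<eta>_defs)
  have \<eta>0: "\<eta> x = 0" "\<eta>1 x = 0" "\<eta>2 x = 0" if "x \<le> 0" for x
    using that by (auto simp: \<eta>_defs)

  define h where "h = (\<lambda>(i::'n) b x. 2 * (norm (fst x))\<^sup>2 * (fst x $ i \<bullet> b) + snd x * twist (axis i b) x)"
  define k where "k = (\<lambda>(i::'n) b x. (4 * (fst x $ i \<bullet> b)\<^sup>2 + 2 * (norm (fst x))\<^sup>2 + (twist (axis i b) x)\<^sup>2) / hgauge x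
           - (h i b x)\<^sup>2 / hgauge x ^ 3)"
  let ?r = "\<lambda>x::'n heis. 1 - hgauge x / R"
  define N where "N = (\<lambda>x. \<eta> (?r x))"
  define N1 where "N1 = (\<lambda>i b x. \<eta>1 (?r x) * (0 - h i b x / hgauge x * (1 / R)))"
  define N2 where "N2 = (\<lambda>i b x. \<eta>2 (?r x) * (0 - h i b x / hgauge x * (1 / R)) * (0 - h i b x / hgauge x * (1 / R))
      + \<eta>1 (?r x) * (0 - k i b x * (1 / R)))"
  have flow_const: "flow_deriv a (\<lambda>_. c) (\<lambda>_. 0)" for a c
    by (simp add: flow_deriv_def)
  have flow_scale: "flow_deriv a (\<lambda>x. c0 - F x * (1 / R)) (\<lambda>x. 0 - F' x * (1 / R))" if "flow_deriv a F F'" for a F F' c0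
    using flow_deriv_diff[OF flow_const flow_deriv_mult[OF that flow_const[of a "1 / R"]]] by simp
  have flows: "flow_deriv (axis i b) N (N1 i b)" "flow_deriv (axis i b) (N1 i b) (N2 i b)"
    if "b \<in> {1, \<i>}" for i b
  proof -
    have nb: "norm b = 1" using that by auto
    have r: "flow_deriv (axis i b) ?r (\<lambda>x. 0 - h i b x / hgauge x * (1 / R))"
      using flow_scale[OF flow_deriv_hgauge(1)[OF nb, of i], of 1] by (simp add: h_def)
    have r': "flow_deriv (axis i b) (\<lambda>x. 0 - h i b x / hgauge x * (1 / R)) (\<lambda>x. 0 - k i b x * (1 / R))"
      using flow_scale[OF flow_deriv_hgauge(2)[OF nb, of i], of 0] by (simp add: h_def k_def)
    show "flow_deriv (axis i b) N (N1 i b)"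
      unfolding N_def N1_def by (rule flow_deriv_compose[OF r D\<eta>(1)])
    show "flow_deriv (axis i b) (N1 i b) (N2 i b)"
      unfolding N1_def N2_def by (rule flow_deriv_mult[OF flow_deriv_compose[OF r D\<eta>(2)] r'])
  qed
  have hne: "hgauge x \<noteq> 0" for x :: "'n heis"
    using hgauge_pos[of x] by simp
  have ct: "continuous_on UNIV (twist a)" for a :: "complex ^ 'n"
    by (rule linear_continuous_on) (simp add: linear_conv_bounded_linear[symmetric] linear_twist)
  have ch: "continuous_on UNIV (h i b)" for i b
    unfolding h_def by (intro continuous_intros ct)
  have ck: "continuous_on UNIV (k i b)" for i b
    unfolding k_def by (intro continuous_intros ct ch) (auto simp: hne)
  have cr: "continuous_on UNIV ?r"
    using R by (intro continuous_intros) auto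
  have cN: "continuous_on UNIV N" "continuous_on UNIV (N1 i b)" "continuous_on UNIV (N2 i b)" for i b
    unfolding N_def N1_def N2_def
    by (intro continuous_intros continuous_on_compose2[OF c\<eta>(1) cr] continuous_on_compose2[OF c\<eta>(2) cr]
          continuous_on_compose2[OF c\<eta>(3) cr] ch ck; simp add: hne)+
  have cT: "continuous_on UNIV (\<lambda>z. F (hmul y z))" if "continuous_on UNIV F" for F :: "'n heis \<Rightarrow> real"
    by (intro continuous_on_compose2[OF that] continuous_intros) auto
  have lower: "(\<Sum>i\<in>UNIV. N2 i 1 x + N2 i \<i> x) \<ge> - K" for x
  proof -
    let ?A = "(norm (fst x))\<^sup>2"
    have one: "N2 i b x \<ge> - ((4 * (norm (fst x $ i))\<^sup>2 + 2 * ?A) / (hgauge x * R))" if b: "b \<in> {1, \<i>}" for i b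
    proof -
      \<comment> \<open>The inner product with \<open>b\<close> and half the twist along
        \<open>b\<close> are, up to sign, the two real coordinates of \<open>fst x $ i\<close>, in
        one order for 1 and in the other for \<open>\<i>\<close>.\<close>
      have eq: "4 * (fst x $ i \<bullet> b)\<^sup>2 + (twist (axis i b) x)\<^sup>2 = 4 * (norm (fst x $ i))\<^sup>2"
        using b by (auto simp: twist_def sum_axis_cnj inner_complex_def cmod_power2 power_mult_distrib)
      have "(4 * (norm (fst x $ i))\<^sup>2 + 2 * ?A) / hgauge x
          = (4 * (fst x $ i \<bullet> b)\<^sup>2 + 2 * ?A + (twist (axis i b) x)\<^sup>2) / hgauge x"
        using eq by simp
      then have "k i b x \<le> (4 * (norm (fst x $ i))\<^sup>2 + 2 * ?A) / hgauge x"
        unfolding k_def using hgauge_pos[of x] by (simp only:) simp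
      then have "\<eta>1 (?r x) * k i b x \<le> 1 * ((4 * (norm (fst x $ i))\<^sup>2 + 2 * ?A) / hgauge x)"
        using \<eta>1_bound[of "?r x"] hgauge_pos[of x]
        by (intro order_trans[OF mult_left_mono mult_right_mono]) auto
      then have "\<eta>1 (?r x) * k i b x * (1 / R) \<le> (4 * (norm (fst x $ i))\<^sup>2 + 2 * ?A) / hgauge x * (1 / R)"
        using R by (intro mult_right_mono) auto
      moreover have "\<eta>2 (?r x) * (0 - h i b x / hgauge x * (1 / R)) * (0 - h i b x / hgauge x * (1 / R)) \<ge> 0"
        unfolding mult.assoc by (intro mult_nonneg_nonneg \<eta>2_pos zero_le_square)
      ultimately show ?thesis
        unfolding N2_def by (simp add: mult.assoc)
    qed
    have "(\<Sum>i\<in>UNIV. N2 i 1 x + N2 i \<i> x) \<ge> (\<Sum>i\<in>UNIV. - (2 * (4 * (norm (fst x $ i))\<^sup>2 + 2 * ?A) / (hgauge x * R)))"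
    proof (rule sum_mono)
      fix i :: 'n
      have dbl: "- (2 * a / b) = - (a / b) + - (a / b)" for a b :: real by simp
      show "- (2 * (4 * (norm (fst x $ i))\<^sup>2 + 2 * ?A) / (hgauge x * R)) \<le> N2 i 1 x + N2 i \<i> x"
        unfolding dbl by (intro add_mono one) simp_all
    qed
    \<comment> \<open>The origin of the constant: two directions per coordinate contribute 8 times
      the squared norm in total, plus 4 times it for each coordinate. The squared norm is at most
      the gauge, which cancels the denominator.\<close>
    moreover have "(\<Sum>i\<in>UNIV. - (2 * (4 * (norm (fst x $ i))\<^sup>2 + 2 * ?A) / (hgauge x * R)))
        = - ((8 + 4 * CARD('n)) * ?A / (hgauge x * R))"
    proof -
      have "(\<Sum>i\<in>UNIV. (norm (fst x $ i))\<^sup>2) = ?A"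
        by (simp add: norm_vec_def L2_set_def sum_nonneg)
      then have "(\<Sum>i\<in>UNIV. 2 * (4 * (norm (fst x $ i))\<^sup>2 + 2 * ?A)) = (8 + 4 * CARD('n)) * ?A"
        by (simp add: sum.distrib sum_distrib_left[symmetric] algebra_simps)
      then show ?thesis
        by (simp add: sum_negf sum_divide_distrib[symmetric])
    qed
    moreover have "(8 + 4 * CARD('n)) * ?A / (hgauge x * R) \<le> K"
    proof -
      have "(8 + 4 * CARD('n)) * ?A \<le> (8 + 4 * CARD('n)) * hgauge x"
        by (intro mult_left_mono hgauge_ge) auto
      then show ?thesis
        unfolding K_def using R hgauge_pos[of x] by (simp add: divide_simps mult.commute)
    qed
    ultimately show ?thesis by linarith
  qed
  have "(LINT z|lborel. p s z * N (hmul y z)) \<ge> N (hmul y 0) - K * s"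
  proof (rule heat_kernel_test[OF p, where ?G1.0 = "\<lambda>i b z. N1 i b (hmul y z)" and ?G2.0 = "\<lambda>i b z. N2 i b (hmul y z)"
        and S = "{z. hgauge (hmul y z) \<le> R}"])
    fix x i b assume "x \<notin> {z. hgauge (hmul y z) \<le> R}"
    then have "?r (hmul y x) \<le> 0" using R by (simp add: field_simps)
    then show "N (hmul y x) = 0 \<and> N1 i b (hmul y x) = 0 \<and> N2 i b (hmul y x) = 0"
      by (simp add: N_def N1_def N2_def \<eta>0)
  qed (use s in \<open>auto intro!: cT cN flow_deriv_left_translate flows lower bounded_hgauge_translate\<close>)
  moreover have "(LINT z|lborel. p s z * N (hmul y z)) \<le> (LINT z|lborel. p s z * max 0 (?r (hmul y z)))"
  proof (rule integral_mono)
    have bnd: "norm (p s z * c) \<le> norm (p s z)" if "0 \<le> c" "c \<le> 1" for c z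
      using that by (simp add: abs_mult mult_left_le)
    have r1: "max 0 (?r z) \<le> 1" for z
      using R hgauge_pos[of z] by simp
    have N1: "0 \<le> N z" "N z \<le> max 0 (?r z)" for z
      using soft_plus_bounds(2)[OF \<epsilon>, of "?r z"] \<epsilon> by (auto simp: N_def \<eta>_defs)
    have meas: "(\<lambda>z. p s z * F (hmul y z)) \<in> borel_measurable lborel" if "continuous_on UNIV F" for F
      using continuous_on_mult[OF heat_kernel_continuous[OF p s] cT[OF that]]
      by (simp add: borel_measurable_continuous_onI)
    show "integrable lborel (\<lambda>z. p s z * N (hmul y z))"
      by (rule Bochner_Integration.integrable_bound[OF heat_kernel_integral(1)[OF p s] meas[OF cN(1)]])
         (intro AE_I2 bnd N1(1) order_trans[OF N1(2) r1])
    have "continuous_on UNIV (\<lambda>z. max 0 (?r z))"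
      by (intro continuous_intros cr)
    then show "integrable lborel (\<lambda>z. p s z * max 0 (?r (hmul y z)))"
      by (intro Bochner_Integration.integrable_bound[OF heat_kernel_integral(1)[OF p s] meas] AE_I2 bnd r1) simp_all
    show "p s z * N (hmul y z) \<le> p s z * max 0 (?r (hmul y z))" for z
      using p s by (intro mult_left_mono N1) (auto simp: heat_kernel_def less_imp_le)
  qed
  moreover have "N (hmul y 0) \<ge> max 0 (?r y) - e"
    using soft_plus_bounds(1)[OF \<epsilon>, of "?r y"] by (simp add: N_def \<eta>_defs \<epsilon>_def hmul_zero)
  ultimately show "max 0 (1 - hgauge y / R) - (8 + 4 * CARD('n)) / R * s
      \<le> (LINT z|lborel. p s z * max 0 (1 - hgauge (hmul y z) / R)) + e"
    by (simp add: K_def)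
qed

section \<open>The integral inequality\<close>

context
  fixes f :: "real \<Rightarrow> real"
  assumes convex_f: "convex_on {0..} f" and f_0: "f 0 = 0" and f_pos: "\<And>v. v > 0 \<Longrightarrow> f v > 0"
begin

lemma f_nonneg: "v \<ge> 0 \<Longrightarrow> f v \<ge> 0"
  using f_pos[of v] f_0 by (cases "v = 0") auto

lemma f_contract:
  assumes "0 \<le> a" "a \<le> 1" "0 \<le> v"
  shows "f (a * v) \<le> a * f v"
  using convex_onD[OF convex_f assms(1,2), of 0 v] assms f_0 by simp

lemma f_mono:
  assumes "0 \<le> a" "a \<le> b"
  shows "f a \<le> f b"
proof (cases "b = 0")
  case False
  then have "f (a / b * b) \<le> a / b * f b"
    using assms by (intro f_contract) (auto simp: divide_le_eq)
  also have "\<dots> \<le> f b"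
    using assms False f_nonneg[of b] by (intro mult_left_le_one_le) (auto simp: divide_le_eq)
  finally show ?thesis using False by simp
qed (use assms in auto)

text \<open>For convex \<open>f\<close> with \<open>f 0 = 0\<close>, the quotient
  \<open>f v / v\<close> is nondecreasing. This allows the exact integral of a weight to be replaced
  by any upper bound for it.\<close>

lemma f_perspective_mono:
  assumes "0 < W" "W \<le> V" "0 \<le> m"
  shows "V * f (m / V) \<le> W * f (m / W)"
proof -
  have "f (W / V * (m / W)) \<le> W / V * f (m / W)"
    using assms by (intro f_contract) auto
  then show ?thesis
    using assms by (simp add: field_simps)
qed

lemma bdd_below_f_minor: "0 \<le> v \<Longrightarrow> bdd_below ((\<lambda>\<alpha>. f (\<alpha> * v) / f \<alpha>) ` {0<..<1})"
  by (intro bdd_belowI2[where m = 0] divide_nonneg_nonneg f_nonneg) auto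

lemma f_minor_le:
  assumes "0 < \<alpha>" "\<alpha> < 1" "0 \<le> v"
  shows "f \<alpha> * f_minor f v \<le> f (\<alpha> * v)"
proof -
  have "f_minor f v \<le> f (\<alpha> * v) / f \<alpha>"
    unfolding f_minor_def using assms by (intro cINF_lower bdd_below_f_minor) auto
  then show ?thesis
    using f_pos[OF assms(1)] by (simp add: pos_le_divide_eq mult.commute)
qed

lemma f_minor_ge:
  assumes "1 \<le> v"
  shows "v \<le> f_minor f v"
  unfolding f_minor_def
proof (rule cINF_greatest)
  fix \<alpha> :: real assume \<alpha>: "\<alpha> \<in> {0<..<1}"
  have "f (1 / v * (\<alpha> * v)) \<le> 1 / v * f (\<alpha> * v)"
    using assms \<alpha> by (intro f_contract) auto
  then show "v \<le> f (\<alpha> * v) / f \<alpha>"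
    using assms f_pos[of \<alpha>] \<alpha> by (simp add: field_simps)
qed simp

text \<open>Besides its use as an order fact, monotonicity gives measurability of this infimum over
  an uncountable family.\<close>

lemma f_minor_mono:
  assumes "0 \<le> v" "v \<le> w"
  shows "f_minor f v \<le> f_minor f w"
  unfolding f_minor_def
proof (rule cINF_mono)
  fix \<alpha> :: real assume \<alpha>: "\<alpha> \<in> {0<..<1}"
  then have "f (\<alpha> * v) / f \<alpha> \<le> f (\<alpha> * w) / f \<alpha>"
    using assms by (intro divide_right_mono f_mono mult_left_mono mult_nonneg_nonneg f_nonneg) auto
  with \<alpha> show "\<exists>\<beta>\<in>{0<..<1}. f (\<beta> * v) / f \<beta> \<le> f (\<alpha> * w) / f \<alpha>" by blast
qed (use assms bdd_below_f_minor in auto)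

text \<open>
  No measurability of \<open>m\<close> is assumed, so the integral is a lower integral. It is replaced
  successively by the monotone minorant \<open>M t = inf {m s | s \<ge> t}\<close>, by a continuous function and by a
  continuously differentiable one, without losing the inequality.
\<close>

lemma integral_inequality_blowup:
  fixes \<phi> m :: "real \<Rightarrow> real" and N :: nat
  assumes cont_f: "continuous_on {0..} f"
    and fin: "(\<integral>\<^sup>+v\<in>{1..}. ennreal (1 / f_minor f v) \<partial>lborel) < \<infinity>"
    and cont_\<phi>: "continuous_on {0..} \<phi>" and \<phi>_nonneg: "\<And>t. t \<ge> 0 \<Longrightarrow> \<phi> t \<ge> 0"
    and div: "\<And>\<epsilon>. \<epsilon> > 0 \<Longrightarrow> (\<integral>\<^sup>+\<tau>\<in>{1..}. ennreal (\<phi> \<tau> * \<tau> ^ N * f (\<epsilon> / \<tau> ^ N)) \<partial>lborel) = \<infinity>"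
    and pos: "0 < c" "0 < m0" "m0 < C"
    and m: "\<And>t. t \<ge> 1 \<Longrightarrow>
      ennreal m0 + (\<integral>\<^sup>+\<tau>\<in>{1<..<t}. ennreal (c * \<phi> \<tau> * (C * \<tau> ^ N) * f (m \<tau> / (C * \<tau> ^ N))) \<partial>lborel) \<le> ennreal (m t)"
  shows False
proof -
  \<comment> \<open>The clamps extend the data continuously to the whole line without changing them
    for times at least 1; the clamp in \<open>V\<close> also keeps \<open>V\<close> above
    \<open>C\<close> everywhere.\<close>
  define F where "F = (\<lambda>v. f (max 0 v))"
  define \<psi> where "\<psi> = (\<lambda>t. c * \<phi> (max 0 t))"
  define V where "V = (\<lambda>t::real. C * max 1 t ^ N)"
  define M where "M = (\<lambda>t. Inf (m ` {max 1 t..}))"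
  have cF: "continuous_on UNIV F"
    unfolding F_def by (intro continuous_on_compose2[OF cont_f] continuous_intros) auto
  have c\<psi>: "continuous_on UNIV \<psi>"
    unfolding \<psi>_def by (intro continuous_intros continuous_on_compose2[OF cont_\<phi>]) auto
  have cV: "continuous_on UNIV V"
    unfolding V_def by (intro continuous_intros)
  have C: "C > 0" using pos by simp
  have V: "V t \<ge> C" "V t > 0" "V t \<noteq> 0" for t
  proof -
    have "C * 1 \<le> V t" unfolding V_def using C by (intro mult_left_mono one_le_power) auto
    then show "V t \<ge> C" "V t > 0" "V t \<noteq> 0" using C by auto
  qed
  have \<psi>_nonneg: "\<psi> t \<ge> 0" for t
    using \<phi>_nonneg pos by (simp add: \<psi>_def)
  have F_nonneg: "F v \<ge> 0" and F_mono: "v \<le> w \<Longrightarrow> F v \<le> F w" for v w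
    by (auto simp: F_def intro!: f_nonneg f_mono)
  have m_ge: "m0 \<le> m t" if "t \<ge> 1" for t
  proof -
    have "ennreal m0 \<le> ennreal (m t)"
      using m[OF that] by (rule order_trans[rotated]) simp
    then show ?thesis using pos by (simp add: ennreal_le_iff2)
  qed
  have M_bdd: "bdd_below (m ` {max 1 t..})" for t
    using m_ge by (intro bdd_belowI2[where m = m0]) auto
  have M_ge: "m0 \<le> M t" for t
    unfolding M_def using m_ge by (intro cINF_greatest) auto
  have M_le: "M t \<le> m s" if "t \<le> s" "1 \<le> s" for t s
    unfolding M_def using that by (intro cINF_lower M_bdd) auto
  have M_mono: "M s \<le> M t" if "s \<le> t" for s t
    unfolding M_def using that by (intro cINF_superset_mono M_bdd) auto

  define h where "h = (\<lambda>t. \<psi> t * V t * F (M t / V t))"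
  have h_nonneg: "0 \<le> h t" for t
    unfolding h_def using V(2)[of t] by (intro mult_nonneg_nonneg \<psi>_nonneg F_nonneg) simp
  have [measurable]: "F \<in> borel_measurable borel" "\<psi> \<in> borel_measurable borel" "V \<in> borel_measurable borel"
    by (intro borel_measurable_continuous_onI cF c\<psi> cV)+
  \<comment> \<open>Monotonicity makes this infimum Borel, whatever \<open>m\<close> is.\<close>
  have [measurable]: "M \<in> borel_measurable borel"
    by (rule borel_measurable_mono) (auto simp: mono_def M_mono)
  have h_meas [measurable]: "h \<in> borel_measurable borel"
    unfolding h_def by measurable
  have h_lower: "(\<integral>\<^sup>+\<tau>\<in>{1<..<t}. ennreal (h \<tau>) \<partial>lborel) + ennreal m0 \<le> ennreal (m t)" if "t \<ge> 1" for t
  proof -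
    have "(\<integral>\<^sup>+\<tau>\<in>{1<..<t}. ennreal (h \<tau>) \<partial>lborel)
        \<le> (\<integral>\<^sup>+\<tau>\<in>{1<..<t}. ennreal (c * \<phi> \<tau> * (C * \<tau> ^ N) * f (m \<tau> / (C * \<tau> ^ N))) \<partial>lborel)"
    proof (rule nn_integral_mono)
      fix \<tau> :: real
      show "ennreal (h \<tau>) * indicator {1<..<t} \<tau>
          \<le> ennreal (c * \<phi> \<tau> * (C * \<tau> ^ N) * f (m \<tau> / (C * \<tau> ^ N))) * indicator {1<..<t} \<tau>"
      proof (cases "\<tau> \<in> {1<..<t}")
        case True
        then have eq: "\<psi> \<tau> = c * \<phi> \<tau>" "V \<tau> = C * \<tau> ^ N" by (auto simp: \<psi>_def V_def)
        have "F (M \<tau> / V \<tau>) \<le> F (m \<tau> / V \<tau>)"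
          using True V(2)[of \<tau>] by (intro F_mono divide_right_mono M_le) auto
        also have "\<dots> = f (m \<tau> / V \<tau>)"
          using True V(2)[of \<tau>] m_ge[of \<tau>] pos by (simp add: F_def)
        finally have "h \<tau> \<le> \<psi> \<tau> * V \<tau> * f (m \<tau> / V \<tau>)"
          unfolding h_def using V(2)[of \<tau>] by (intro mult_left_mono mult_nonneg_nonneg \<psi>_nonneg) auto
        then show ?thesis using True by (simp add: eq ennreal_leI)
      qed simp
    qed
    then have "(\<integral>\<^sup>+\<tau>\<in>{1<..<t}. ennreal (h \<tau>) \<partial>lborel) + ennreal m0
        \<le> (\<integral>\<^sup>+\<tau>\<in>{1<..<t}. ennreal (c * \<phi> \<tau> * (C * \<tau> ^ N) * f (m \<tau> / (C * \<tau> ^ N))) \<partial>lborel) + ennreal m0"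
      by (rule add_right_mono)
    also have "\<dots> \<le> ennreal (m t)"
      using m[OF that] by (simp only: add.commute)
    finally show ?thesis .
  qed
  have h_int: "set_integrable lborel {1..t} h" for t
  proof -
    have "(\<integral>\<^sup>+\<tau>. ennreal (norm (indicator {1..t} \<tau> *\<^sub>R h \<tau>)) \<partial>lborel)
        \<le> (\<integral>\<^sup>+\<tau>\<in>{1<..<max 1 t}. ennreal (h \<tau>) \<partial>lborel)"
    proof (rule nn_integral_mono_AE)
      show "AE \<tau> in lborel. ennreal (norm (indicator {1..t} \<tau> *\<^sub>R h \<tau>)) \<le> ennreal (h \<tau>) * indicator {1<..<max 1 t} \<tau>"
        using AE_lborel_singleton[of 1] AE_lborel_singleton[of t]
        by eventually_elim (auto simp: indicator_def h_nonneg)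
    qed
    also have "\<dots> \<le> (\<integral>\<^sup>+\<tau>\<in>{1<..<max 1 t}. ennreal (h \<tau>) \<partial>lborel) + ennreal m0"
      by simp
    also have "\<dots> \<le> ennreal (m (max 1 t))"
      by (rule h_lower) simp
    also have "\<dots> < \<infinity>" by simp
    finally show ?thesis
      unfolding set_integrable_def by (intro integrableI_bounded) auto
  qed
  have hk: "h integrable_on {1..t}" for t
    using set_borel_integral_eq_integral(1)[OF h_int] .

  define G where "G = (\<lambda>t. m0 + integral {1..max 1 t} h)"
  \<comment> \<open>Every competitor \<open>s\<close> in the infimum satisfies the integral
    inequality up to \<open>s\<close>; as \<open>h\<close> is nonnegative, the upper limit may be
    lowered to \<open>max 1 t\<close>.\<close>
  have G_le: "G t \<le> M t" for t
    unfolding M_def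
  proof (rule cINF_greatest)
    fix s assume s: "s \<in> {max 1 t..}"
    have "integral {1..s} h = (LINT \<tau>:{1..s}|lborel. h \<tau>)"
      using set_borel_integral_eq_integral(2)[OF h_int] by simp
    also have "\<dots> = (LINT \<tau>:{1<..<s}|lborel. h \<tau>)"
      unfolding set_lebesgue_integral_def
    proof (rule integral_cong_AE)
      show "AE \<tau> in lborel. indicat_real {1..s} \<tau> *\<^sub>R h \<tau> = indicat_real {1<..<s} \<tau> *\<^sub>R h \<tau>"
        using AE_lborel_singleton[of 1] AE_lborel_singleton[of s]
        by eventually_elim (auto simp: indicator_def)
    qed measurable
    finally have eq: "integral {1..s} h = (LINT \<tau>:{1<..<s}|lborel. h \<tau>)" .
    have si: "set_integrable lborel {1<..<s} h"
      by (rule set_integrable_subset[OF h_int[of s]]) auto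
    have "(\<integral>\<^sup>+\<tau>. ennreal (indicator {1<..<s} \<tau> *\<^sub>R h \<tau>) \<partial>lborel) = ennreal (integral {1..s} h)"
      unfolding eq set_lebesgue_integral_def
      using si h_nonneg unfolding set_integrable_def by (intro nn_integral_eq_integral) (auto intro!: AE_I2)
    moreover have "(\<integral>\<^sup>+\<tau>. ennreal (indicator {1<..<s} \<tau> *\<^sub>R h \<tau>) \<partial>lborel) = (\<integral>\<^sup>+\<tau>\<in>{1<..<s}. ennreal (h \<tau>) \<partial>lborel)"
      by (intro nn_integral_cong) (auto simp: indicator_def)
    ultimately have "ennreal (integral {1..s} h) = (\<integral>\<^sup>+\<tau>\<in>{1<..<s}. ennreal (h \<tau>) \<partial>lborel)"
      by simp
    then have "ennreal (integral {1..s} h) + ennreal m0 \<le> ennreal (m s)"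
      using h_lower[of s] s by simp
    moreover have "0 \<le> integral {1..s} h"
      by (rule Henstock_Kurzweil_Integration.integral_nonneg[OF hk]) (rule h_nonneg)
    ultimately have "ennreal (integral {1..s} h + m0) \<le> ennreal (m s)"
      using pos by simp
    then have "integral {1..s} h + m0 \<le> m s"
      using m_ge[of s] s pos by (subst (asm) ennreal_le_iff) auto
    moreover have "integral {1..max 1 t} h \<le> integral {1..s} h"
      using s h_nonneg by (intro integral_subset_le hk) auto
    ultimately show "G t \<le> m s" by (simp add: G_def)
  qed simp
  have cG: "continuous_on UNIV G"
  proof (rule continuous_at_imp_continuous_on, rule ballI)
    fix x :: real
    have "continuous_on {..x + 1} (\<lambda>t. integral {1..max 1 t} h)"
      by (rule continuous_on_compose2[OF indefinite_integral_continuous_1[OF hk[of "max 1 (x + 1)"]]])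
         (auto intro!: continuous_intros)
    then have "continuous_on {..x + 1} G"
      unfolding G_def by (intro continuous_intros)
    then show "isCont G x"
      by (rule continuous_on_interior) simp
  qed

  \<comment> \<open>\<open>M\<close> may jump, whereas \<open>G\<close> is continuous; so
    \<open>k\<close> is continuous and its integral \<open>E\<close> is differentiable. As
    \<open>k\<close> is at most \<open>h\<close>, \<open>E\<close> stays below \<open>G\<close>, and
    therefore the derivative of \<open>E\<close> is at least
    \<open>\<psi> t * V t * F (E t / V t)\<close>.\<close>
  define k where "k = (\<lambda>t. \<psi> t * V t * F (G t / V t))"
  have ck: "continuous_on UNIV k"
    unfolding k_def using V(3) by (intro continuous_intros c\<psi> cV cG continuous_on_compose2[OF cF]) auto
  have k_nonneg: "0 \<le> k t" for t
    unfolding k_def using V(2)[of t] by (intro mult_nonneg_nonneg \<psi>_nonneg F_nonneg) simp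
  have k_le: "k t \<le> h t" for t
    unfolding k_def h_def using V(2)[of t]
    by (intro mult_left_mono F_mono divide_right_mono G_le mult_nonneg_nonneg \<psi>_nonneg) auto
  have ki: "k integrable_on {a..b}" for a b
    by (intro integrable_continuous_real continuous_on_subset[OF ck]) auto
  \<comment> \<open>The base point 0 keeps \<open>t = 1\<close> in the interior, so the derivative
    is two-sided there as well.\<close>
  define E where "E = (\<lambda>t. m0 + integral {0..t} k - integral {0..1} k)"
  have E_eq: "E t = m0 + integral {1..t} k" if "t \<ge> 1" for t
    using Henstock_Kurzweil_Integration.integral_combine[where a = 0 and c = 1 and b = t and f = k] that ki by (simp add: E_def)
  have E_le: "E t \<le> G t" if "t \<ge> 1" for t
    using that k_le integral_le[OF ki hk[of t]] by (simp add: E_eq G_def)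
  have E_ge: "m0 \<le> E t" if "t \<ge> 1" for t
    using that k_nonneg by (simp add: E_eq Henstock_Kurzweil_Integration.integral_nonneg ki)
  have DE: "(E has_real_derivative k t) (at t)" if "t > 0" for t
  proof -
    have "((\<lambda>t. integral {0..t} k) has_real_derivative k t) (at t within {0..t + 1})"
      using that by (intro integral_has_real_derivative continuous_on_subset[OF ck]) auto
    then have "((\<lambda>t. integral {0..t} k) has_real_derivative k t) (at t)"
      using that by (subst (asm) at_within_interior) auto
    then show ?thesis
      unfolding E_def by (auto intro!: derivative_eq_intros)
  qed

  \<comment> \<open>For times at least 1 and up to the factor \<open>c * C / m0\<close>, this is the
    integrand of \<open>div\<close> at \<open>\<epsilon> = m0 / C\<close>.\<close>
  define \<beta> where "\<beta> = (\<lambda>t. \<psi> t * V t * F (m0 / V t) / m0)"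
  have c\<beta>: "continuous_on UNIV \<beta>"
    unfolding \<beta>_def using V(3) pos by (intro continuous_intros c\<psi> cV continuous_on_compose2[OF cF]) auto
  have \<beta>_le: "\<beta> t \<le> 1 / f_minor f (E t / m0) * (k t / m0)" if "t \<ge> 1" for t
  proof -
    have v: "1 \<le> E t / m0" using E_ge[OF that] pos by simp
    have fm: "0 < f_minor f (E t / m0)" using f_minor_ge[OF v] v by linarith
    \<comment> \<open>The assumption \<open>m0 < C\<close> enters here: \<open>m0 / V t\<close> is
      an admissible point in the infimum defining \<open>f_minor\<close>.\<close>
    have \<alpha>: "0 < m0 / V t" "m0 / V t < 1" using pos V(1,2)[of t] by auto
    have "F (m0 / V t) * f_minor f (E t / m0) = f (m0 / V t) * f_minor f (E t / m0)"
      using \<alpha> by (simp add: F_def)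
    also have "\<dots> \<le> f (m0 / V t * (E t / m0))"
      using \<alpha> v by (intro f_minor_le) auto
    also have "\<dots> = F (E t / V t)"
      using pos V(2)[of t] E_ge[OF that] by (simp add: F_def)
    also have "\<dots> \<le> F (G t / V t)"
      using V(2)[of t] E_le[OF that] by (intro F_mono divide_right_mono) auto
    finally have "\<psi> t * V t * (F (m0 / V t) * f_minor f (E t / m0)) \<le> k t"
      unfolding k_def using V(2)[of t] by (intro mult_left_mono mult_nonneg_nonneg \<psi>_nonneg) auto
    then show ?thesis
      using fm pos by (simp add: \<beta>_def field_simps)
  qed
  have E1: "E 1 / m0 = 1" using pos by (simp add: E_def)
  let ?L = "\<integral>\<^sup>+v\<in>{1..}. ennreal (1 / f_minor f v) \<partial>lborel"
  have bound: "(\<integral>\<^sup>+t\<in>{1..T}. ennreal (\<beta> t) \<partial>lborel) \<le> ?L" if T: "T \<ge> 1" for T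
  proof -
    have meas: "(\<lambda>x. f_minor f (max 1 x)) \<in> borel_measurable borel"
      by (rule borel_measurable_mono) (auto simp: mono_def intro!: f_minor_mono)
    have "(\<integral>\<^sup>+t\<in>{1..T}. ennreal (\<beta> t) \<partial>lborel)
        \<le> (\<integral>\<^sup>+t. ennreal (1 / f_minor f (E t / m0)) * ennreal (k t / m0) * indicator {1..T} t \<partial>lborel)"
    proof (rule nn_integral_mono)
      fix t
      show "ennreal (\<beta> t) * indicator {1..T} t
          \<le> ennreal (1 / f_minor f (E t / m0)) * ennreal (k t / m0) * indicator {1..T} t"
        using \<beta>_le[of t] k_nonneg[of t] pos
        by (auto simp: indicator_def ennreal_mult''[symmetric] intro!: ennreal_leI)
    qed
    also have "\<dots> = (\<integral>\<^sup>+t. ennreal (1 / f_minor f (E t / m0) * (k t / m0) * indicator {1..T} t) \<partial>lborel)"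
      using k_nonneg pos
      by (intro nn_integral_cong) (auto simp: indicator_def ennreal_mult''[symmetric])
    \<comment> \<open>Substitution \<open>v = E t / m0\<close>, which starts at 1 and never
      decreases; the image stays in the range of \<open>?L\<close>, so the bound is independent of
      \<open>T\<close>.\<close>
    also have "\<dots> = (\<integral>\<^sup>+x. ennreal (1 / f_minor f x * indicator {E 1 / m0..E T / m0} x) \<partial>lborel)"
    proof (rule nn_integral_substitution[symmetric])
      have "(\<lambda>x. indicat_real {1..E T / m0} x *\<^sub>R (1 / f_minor f x))
          = (\<lambda>x. indicat_real {1..E T / m0} x *\<^sub>R (1 / f_minor f (max 1 x)))"
        by (auto simp: indicator_def fun_eq_iff max_def)
      then show "set_borel_measurable borel {E 1 / m0..E T / m0} (\<lambda>x. 1 / f_minor f x)"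
        unfolding set_borel_measurable_def E1 using meas by simp
      show "((\<lambda>t. E t / m0) has_real_derivative k t / m0) (at t)" if "t \<in> {1..T}" for t
        using DE[of t] that by (intro DERIV_cdivide) auto
      show "continuous_on {1..T} (\<lambda>t. k t / m0)"
        using pos by (intro continuous_intros continuous_on_subset[OF ck]) auto
    qed (use T k_nonneg pos in auto)
    also have "\<dots> \<le> ?L"
      by (intro nn_integral_mono) (auto simp: E1 indicator_def)
    finally show ?thesis .
  qed
  have "(\<integral>\<^sup>+t\<in>{1..}. ennreal (\<beta> t) \<partial>lborel) = (SUP n. \<integral>\<^sup>+t. ennreal (\<beta> t) * indicator {1..real n + 1} t \<partial>lborel)"
  proof -
    have "(\<integral>\<^sup>+t\<in>{1..}. ennreal (\<beta> t) \<partial>lborel) = (\<integral>\<^sup>+t. (SUP n. ennreal (\<beta> t) * indicator {1..real n + 1} t) \<partial>lborel)"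
    proof (rule nn_integral_cong, rule antisym)
      fix t :: real
      obtain n where "t \<le> real n + 1" using real_arch_simple[of "t - 1"] by (auto simp: algebra_simps)
      then show "ennreal (\<beta> t) * indicator {1..} t \<le> (SUP n. ennreal (\<beta> t) * indicator {1..real n + 1} t)"
        by (intro SUP_upper2[of n]) (auto simp: indicator_def)
      show "(SUP n. ennreal (\<beta> t) * indicator {1..real n + 1} t) \<le> ennreal (\<beta> t) * indicator {1..} t"
        by (intro SUP_least) (auto simp: indicator_def)
    qed
    also have "\<dots> = (SUP n. \<integral>\<^sup>+t. ennreal (\<beta> t) * indicator {1..real n + 1} t \<partial>lborel)"
    proof (rule nn_integral_monotone_convergence_SUP)
      show "incseq (\<lambda>n t. ennreal (\<beta> t) * indicator {1..real n + 1} t)"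
        by (auto simp: incseq_def le_fun_def indicator_def)
      show "(\<lambda>t. ennreal (\<beta> t) * indicator {1..real n + 1} t) \<in> borel_measurable lborel" for n
        using borel_measurable_continuous_onI[OF c\<beta>] by simp
    qed
    finally show ?thesis .
  qed
  also have "\<dots> \<le> ?L"
    by (intro SUP_least bound) simp
  finally have le: "(\<integral>\<^sup>+t\<in>{1..}. ennreal (\<beta> t) \<partial>lborel) \<le> ?L" .
  have "(\<integral>\<^sup>+t\<in>{1..}. ennreal (\<beta> t) \<partial>lborel)
      = (\<integral>\<^sup>+t. ennreal (c * C / m0) * (ennreal (\<phi> t * t ^ N * f (m0 / C / t ^ N)) * indicator {1..} t) \<partial>lborel)"
  proof (rule nn_integral_cong)
    fix t :: real
    show "ennreal (\<beta> t) * indicator {1..} t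
        = ennreal (c * C / m0) * (ennreal (\<phi> t * t ^ N * f (m0 / C / t ^ N)) * indicator {1..} t)"
    proof (cases "t \<ge> 1")
      case True
      then have "\<beta> t = c * C / m0 * (\<phi> t * t ^ N * f (m0 / C / t ^ N))"
        using pos C by (simp add: \<beta>_def \<psi>_def V_def F_def mult_ac)
      then show ?thesis
        using True pos C by (simp add: ennreal_mult'[symmetric])
    qed simp
  qed
  also have "\<dots> = ennreal (c * C / m0) * \<infinity>"
  proof -
    have "(\<lambda>t. \<phi> t * t ^ N * f (m0 / C / t ^ N)) \<in> borel_measurable (restrict_space borel {1..})"
    proof (rule borel_measurable_continuous_on_restrict)
      show "continuous_on {1..} (\<lambda>t. \<phi> t * t ^ N * f (m0 / C / t ^ N))"
        using pos C
        by (intro continuous_intros continuous_on_subset[OF cont_\<phi>] continuous_on_compose2[OF cont_f]) auto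
    qed
    then have "(\<lambda>t. ennreal (\<phi> t * t ^ N * f (m0 / C / t ^ N)) * indicator {1..} t) \<in> borel_measurable lborel"
      by (subst borel_measurable_restrict_space_iff_ennreal[symmetric]) auto
    then show ?thesis
      using div[of "m0 / C"] pos C by (subst nn_integral_cmult) auto
  qed
  also have "\<dots> = \<infinity>"
    using pos C by (simp add: ennreal_mult_top)
  finally show False using le fin by simp
qed

end

section \<open>Weighted masses\<close>

lemma AE_bounded_of_esssup:
  assumes "esssup M (\<lambda>x. ereal \<bar>g x\<bar>) < \<infinity>"
  shows "(\<lambda>x. \<bar>g x\<bar>) \<in> borel_measurable M" "\<exists>B. AE x in M. \<bar>g x\<bar> \<le> B"
proof -
  have "(\<lambda>x. ereal \<bar>g x\<bar>) \<in> borel_measurable M"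
    using assms by (auto simp: esssup_def top_ereal_def split: if_splits)
  then show "(\<lambda>x. \<bar>g x\<bar>) \<in> borel_measurable M" by simp
  obtain B where B: "esssup M (\<lambda>x. ereal \<bar>g x\<bar>) \<le> ereal B"
    using assms by (cases "esssup M (\<lambda>x. ereal \<bar>g x\<bar>)") auto
  have "AE x in M. \<bar>g x\<bar> \<le> B"
    using esssup_AE[of "\<lambda>x. ereal \<bar>g x\<bar>" M]
  proof eventually_elim
    case (elim x)
    then have "ereal \<bar>g x\<bar> \<le> ereal B" using B by (rule order_trans)
    then show ?case by simp
  qed
  then show "\<exists>B. AE x in M. \<bar>g x\<bar> \<le> B" ..
qed

lemma C0_bounded:
  fixes g :: "'a::euclidean_space \<Rightarrow> real"
  assumes "g \<in> C0"
  shows "\<exists>B. \<forall>x. \<bar>g x\<bar> \<le> B"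
proof -
  have g: "continuous_on UNIV g" "(g \<longlongrightarrow> 0) at_infinity"
    using assms by (auto simp: C0_def)
  obtain r where r: "\<And>x. norm x \<ge> r \<Longrightarrow> \<bar>g x\<bar> < 1"
    using tendstoD[OF g(2), of 1] by (auto simp: eventually_at_infinity)
  have "compact (g ` cball 0 r)"
    by (intro compact_continuous_image continuous_on_subset[OF g(1)]) auto
  then obtain B where "\<forall>y\<in>g ` cball 0 r. norm y \<le> B"
    using compact_imp_bounded bounded_iff by blast
  then have B: "\<bar>g x\<bar> \<le> B" if "x \<in> cball 0 r" for x
    using that by simp
  have "\<bar>g x\<bar> \<le> max 1 B" for x
    using r[of x] B[of x] by (cases "norm x \<ge> r") auto
  then show ?thesis by blast
qed

lemma heat_semigroup_nonneg:
  assumes "heat_kernel p" "s > 0" "\<And>y. 0 \<le> g y"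
  shows "0 \<le> heat_semigroup p s g x"
  unfolding heat_semigroup_def
  by (intro Bochner_Integration.integral_nonneg mult_nonneg_nonneg less_imp_le[OF heat_kernel_pos] assms)

lemma heat_semigroup_bounded:
  fixes p :: "real \<Rightarrow> 'n::finite heis \<Rightarrow> real"
  assumes p: "heat_kernel p" "s > 0" and g: "g \<in> borel_measurable borel" "AE y in lborel. \<bar>g y\<bar> \<le> B"
  shows "integrable lborel (\<lambda>y. p s (hmul (hinv y) x) * g y)"
    and "continuous_on UNIV (heat_semigroup p s g)"
  using continuous_convolution[OF heat_kernel_continuous[OF p] heat_kernel_integral(1)[OF p] g]
  by (auto simp: heat_semigroup_def[abs_def])

text \<open>Tonelli moves the kernel from \<open>g\<close> to \<open>w\<close>, and the substitution
  \<open>x = hmul y z\<close> turns the inner integral into the average of \<open>w\<close> over the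
  heat flow from \<open>y\<close>. The lower bound \<open>l\<close> is left open because it is
  supplied differently for the initial value and for the source.\<close>

lemma nn_integral_heat_semigroup:
  fixes p :: "real \<Rightarrow> 'n::finite heis \<Rightarrow> real"
  assumes p: "heat_kernel p" "s > 0"
    and g: "g \<in> borel_measurable borel" "AE y in lborel. \<bar>g y\<bar> \<le> B" "\<And>y. g y \<ge> 0"
    and w: "continuous_on UNIV w" "\<And>x. w x \<ge> 0"
    and l: "\<And>y. (LINT z|lborel. p s z * w (hmul y z)) \<ge> l y" and wb: "\<And>x. w x \<le> 1"
  shows "(\<integral>\<^sup>+y. ennreal (g y) * ennreal (l y) \<partial>lborel)
    \<le> (\<integral>\<^sup>+x. ennreal (heat_semigroup p s g x) * ennreal (w x) \<partial>lborel)"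
proof -
  have p0: "p s x \<ge> 0" for x using heat_kernel_pos[OF p, of x] by simp
  have cp: "continuous_on UNIV (p s)" by (rule heat_kernel_continuous[OF p])
  note [measurable] = g(1) borel_measurable_continuous_onI[OF w(1)]
  have "(\<lambda>z. p s (hmul (hinv (snd z)) (fst z))) \<in> borel_measurable borel"
    by (intro borel_measurable_continuous_onI continuous_on_compose2[OF cp] continuous_intros) auto
  then have [measurable]: "(\<lambda>z. p s (hmul (hinv (snd z)) (fst z))) \<in> borel_measurable (lborel \<Otimes>\<^sub>M lborel)"
    by (simp add: lborel_prod)
  have [measurable]: "(\<lambda>x. p s (hmul (hinv y) x)) \<in> borel_measurable borel"
      "(\<lambda>y. p s (hmul (hinv y) x)) \<in> borel_measurable borel" for x y
    by (intro borel_measurable_continuous_onI continuous_on_compose2[OF cp] continuous_intros; simp)+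
  have "(\<integral>\<^sup>+x. ennreal (heat_semigroup p s g x) * ennreal (w x) \<partial>lborel)
      = (\<integral>\<^sup>+x. (\<integral>\<^sup>+y. ennreal (p s (hmul (hinv y) x) * g y) \<partial>lborel) * ennreal (w x) \<partial>lborel)"
    unfolding heat_semigroup_def using heat_semigroup_bounded(1)[OF p g(1,2)] p0 g(3)
    by (intro nn_integral_cong) (subst nn_integral_eq_integral, auto)
  also have "\<dots> = (\<integral>\<^sup>+x. (\<integral>\<^sup>+y. ennreal (p s (hmul (hinv y) x) * g y) * ennreal (w x) \<partial>lborel) \<partial>lborel)"
    by (intro nn_integral_cong nn_integral_multc[symmetric]) simp
  also have "\<dots> = (\<integral>\<^sup>+y. (\<integral>\<^sup>+x. ennreal (p s (hmul (hinv y) x) * g y) * ennreal (w x) \<partial>lborel) \<partial>lborel)"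
    by (rule lborel_pair.Fubini'[symmetric]) (simp add: case_prod_beta')
  also have "\<dots> = (\<integral>\<^sup>+y. ennreal (g y) * (\<integral>\<^sup>+x. ennreal (p s (hmul (hinv y) x) * w x) \<partial>lborel) \<partial>lborel)"
    using p0 g(3) w(2)
    by (intro nn_integral_cong, subst nn_integral_cmult[symmetric])
       (auto simp: ennreal_mult mult_ac intro!: nn_integral_cong)
  also have "\<dots> = (\<integral>\<^sup>+y. ennreal (g y) * ennreal (LINT z|lborel. p s z * w (hmul y z)) \<partial>lborel)"
  proof (intro nn_integral_cong arg_cong2[where f = "(*)"] refl)
    fix y
    have "(\<integral>\<^sup>+x. ennreal (p s (hmul (hinv y) x) * w x) \<partial>lborel)
        = (\<integral>\<^sup>+x. ennreal (p s (hmul (hinv y) (hmul y x)) * w (hmul y x)) \<partial>lborel)"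
      by (rule nn_integral_hmul_left[symmetric]) simp
    also have "\<dots> = (\<integral>\<^sup>+z. ennreal (p s z * w (hmul y z)) \<partial>lborel)"
      by (simp add: hmul_assoc[symmetric] hmul_hinv hmul_zero)
    also have "\<dots> = ennreal (LINT z|lborel. p s z * w (hmul y z))"
    proof (rule nn_integral_eq_integral)
      show "integrable lborel (\<lambda>z. p s z * w (hmul y z))"
      proof (rule Bochner_Integration.integrable_bound[OF heat_kernel_integral(1)[OF p]])
        have "continuous_on UNIV (\<lambda>z. p s z * w (hmul y z))"
          by (intro continuous_on_mult cp continuous_on_compose2[OF w(1)] continuous_intros) auto
        then show "(\<lambda>z. p s z * w (hmul y z)) \<in> borel_measurable lborel"
          by (simp add: borel_measurable_continuous_onI)
        show "AE z in lborel. norm (p s z * w (hmul y z)) \<le> norm (p s z)"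
          using w(2) wb by (intro AE_I2) (simp add: abs_mult mult_left_le)
      qed
    qed (use p0 w(2) in auto)
    finally show "(\<integral>\<^sup>+x. ennreal (p s (hmul (hinv y) x) * w x) \<partial>lborel)
        = ennreal (LINT z|lborel. p s z * w (hmul y z))" .
  qed
  finally show ?thesis
    by (simp only:) (intro nn_integral_mono mult_left_mono ennreal_leI l, simp)
qed

text \<open>A supporting line of \<open>f\<close> at the weighted mean, multiplied by
  \<open>w\<close> and integrated, gives Jensen for the exact mass of \<open>w\<close>; monotonicity
  of the perspective then passes to the larger \<open>V\<close>.\<close>

lemma jensen_weighted:
  fixes f :: "real \<Rightarrow> real" and u w :: "'a \<Rightarrow> real"
  assumes f: "continuous_on {0..} f" "convex_on {0..} f" "f 0 = 0" "\<And>v. v > 0 \<Longrightarrow> f v > 0"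
    and u: "u \<in> borel_measurable M" "\<And>x. u x \<ge> 0" "AE x in M. \<bar>u x\<bar> \<le> B"
    and w: "integrable M w" "\<And>x. w x \<ge> 0" and W: "0 < integral\<^sup>L M w" "integral\<^sup>L M w \<le> V"
  shows "ennreal (V * f ((LINT x|M. u x * w x) / V)) \<le> (\<integral>\<^sup>+x. ennreal (f (u x)) * ennreal (w x) \<partial>M)"
proof -
  let ?W = "integral\<^sup>L M w" and ?m = "LINT x|M. u x * w x"
  note [measurable] = u(1) borel_measurable_integrable[OF w(1)]
  have fm [measurable]: "(\<lambda>x. f (u x)) \<in> borel_measurable M"
  proof -
    have "(\<lambda>v. f (max 0 v)) \<in> borel_measurable borel"
      by (intro borel_measurable_continuous_onI continuous_on_compose2[OF f(1)] continuous_intros) auto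
    then have "(\<lambda>x. f (max 0 (u x))) \<in> borel_measurable M"
      by (rule measurable_compose[OF u(1)])
    then show ?thesis using u(2) by (simp add: max_absorb2)
  qed
  have iu: "integrable M (\<lambda>x. u x * w x)"
  proof (rule Bochner_Integration.integrable_bound)
    show "integrable M (\<lambda>x. B * w x)" using w(1) by simp
    show "AE x in M. norm (u x * w x) \<le> norm (B * w x)"
      using u(3) by eventually_elim (use w(2) in \<open>auto simp: abs_mult intro!: mult_right_mono\<close>)
  qed simp
  have fn: "f v \<ge> 0" if "v \<ge> 0" for v
    by (rule f_nonneg[OF f(2-4) that])
  have ifu: "integrable M (\<lambda>x. f (u x) * w x)"
  proof (rule Bochner_Integration.integrable_bound)
    show "integrable M (\<lambda>x. f B * w x)" using w(1) by simp
    show "AE x in M. norm (f (u x) * w x) \<le> norm (f B * w x)"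
      using u(3)
    proof eventually_elim
      case (elim x)
      then have "f (u x) \<le> f B"
        using f_mono[OF f(2-4)] u(2)[of x] by auto
      then show ?case
        using w(2)[of x] fn[of "u x"] u(2)[of x] by (auto simp: abs_mult intro!: mult_right_mono)
    qed
  qed simp
  have m0: "?m \<ge> 0" using u(2) w(2) by simp
  define a where "a = ?m / ?W"
  have a0: "a \<ge> 0" using m0 W by (simp add: a_def)
  have jensen: "?W * f a \<le> (LINT x|M. f (u x) * w x)"
  proof (cases "a = 0")
    case True
    then show ?thesis using f(3) fn u(2) w(2) by simp
  next
    case False
    then have "a \<in> interior {0..}" using a0 by (simp add: interior_real_atLeast)
    then obtain \<kappa> where \<kappa>: "\<And>v. v \<ge> 0 \<Longrightarrow> f v \<ge> f a + \<kappa> * (v - a)"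
      using convex_le_Inf_differential[OF f(2)] by (metis atLeast_iff)
    have "?W * f a = (LINT x|M. f a * w x + \<kappa> * (u x * w x - a * w x))"
      using w(1) iu W by (simp add: a_def)
    also have "\<dots> \<le> (LINT x|M. f (u x) * w x)"
    proof (rule integral_mono)
      show "integrable M (\<lambda>x. f a * w x + \<kappa> * (u x * w x - a * w x))"
        using w(1) iu by simp
      show "f a * w x + \<kappa> * (u x * w x - a * w x) \<le> f (u x) * w x" for x
        using mult_right_mono[OF \<kappa>[OF u(2)] w(2), of x x] by (simp add: algebra_simps)
    qed (rule ifu)
    finally show ?thesis .
  qed
  have "V * f (?m / V) \<le> ?W * f (?m / ?W)"
    by (rule f_perspective_mono[OF f(2-4) W m0])
  then have "ennreal (V * f (?m / V)) \<le> ennreal (LINT x|M. f (u x) * w x)"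
    using jensen by (intro ennreal_leI) (simp add: a_def)
  also have "\<dots> = (\<integral>\<^sup>+x. ennreal (f (u x)) * ennreal (w x) \<partial>M)"
    using fn u(2) w(2)
    by (subst nn_integral_eq_integral[OF ifu, symmetric]) (auto simp: ennreal_mult intro!: nn_integral_cong)
  finally show ?thesis .
qed

section \<open>The expanding weight and its total mass\<close>

definition cutoff :: "real \<Rightarrow> 'n::finite heis \<Rightarrow> real" where
  "cutoff R x = max 0 (1 - hgauge x / R)"

lemma cutoff_bounds: "0 \<le> cutoff R x" "R > 0 \<Longrightarrow> cutoff R x \<le> 1"
  using hgauge_pos[of x] by (auto simp: cutoff_def)

lemma continuous_cutoff: "continuous_on UNIV (cutoff R)"
  unfolding cutoff_def[abs_def] divide_inverse by (intro continuous_intros)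

lemma cutoff_eq_0: "R > 0 \<Longrightarrow> hgauge x \<ge> R \<Longrightarrow> cutoff R x = 0"
  by (simp add: cutoff_def)

lemma integrable_cutoff:
  assumes "R > 0"
  shows "integrable lborel (cutoff R :: 'n::finite heis \<Rightarrow> real)"
proof -
  obtain l u :: "'n heis" where lu: "{x. hgauge x \<le> R} \<subseteq> cbox l u"
    using bounded_subset_cbox_symmetric[OF bounded_hgauge] by metis
  show ?thesis
    by (rule lborel_integral_eq_integral_cbox(1)[OF continuous_cutoff, of l u])
       (use lu assms in \<open>auto intro!: cutoff_eq_0 simp: subset_iff\<close>, meson nle_le)
qed

text \<open>Used by contradiction to show that the weights and the initial weighted mass are
  strictly positive.\<close>

lemma open_AE_imp_empty:
  fixes S :: "'a::euclidean_space set"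
  assumes "open S" "AE x in lborel. x \<notin> S"
  shows "S = {}"
proof -
  have "S \<in> null_sets lborel"
    using assms by (simp add: AE_iff_null_sets)
  then have "negligible S"
    by (simp add: negligible_iff_null_sets null_sets_completionI)
  then show ?thesis
    using open_not_negligible assms(1) by blast
qed

text \<open>The gauge attains its least value 1 at the identity, whence the threshold for
  \<open>R\<close>.\<close>

lemma integral_cutoff_pos:
  assumes "R > 1"
  shows "0 < (LINT x|lborel. cutoff R (x :: 'n::finite heis))"
proof -
  have "(LINT x|lborel. cutoff R (x :: 'n heis)) \<noteq> 0"
  proof
    assume "(LINT x|lborel. cutoff R (x :: 'n heis)) = 0"
    then have "AE x in lborel. cutoff R (x :: 'n heis) = 0"
      using assms
      by (subst (asm) integral_nonneg_eq_0_iff_AE) (auto intro!: AE_I2 integrable_cutoff cutoff_bounds)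
    then have ae: "AE x in lborel. (x :: 'n heis) \<notin> {x. hgauge x < R}"
      by eventually_elim (use assms in \<open>auto simp: cutoff_def max_def split: if_splits\<close>)
    have "open {x :: 'n heis. hgauge x < R}"
      by (intro open_Collect_less continuous_intros)
    from open_AE_imp_empty[OF this ae] have "\<not> hgauge (0 :: 'n heis) < R" by blast
    then show False using assms by (simp add: hgauge_def)
  qed
  moreover have "0 \<le> (LINT x|lborel. cutoff R (x :: 'n heis))"
    by (intro Bochner_Integration.integral_nonneg cutoff_bounds)
  ultimately show ?thesis by simp
qed

text \<open>The support lies in a ball of radius \<open>sqrt R\<close>, in real dimension
  \<open>2 * n\<close>, times an interval of length \<open>2 * R\<close>; this has volume of order
  \<open>R ^ (n + 1)\<close>. The exponent grows to \<open>2 * n\<close> because \<open>n\<close>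
  and \<open>t\<close> are at least 1.\<close>

lemma integral_cutoff_le:
  fixes A :: real
  assumes A: "A > 0"
  obtains C where "C > 0"
    "\<And>t. t \<ge> 1 \<Longrightarrow> (LINT x|lborel. cutoff (A * t) (x :: 'n::finite heis)) \<le> C * t ^ (2 * CARD('n))"
proof
  let ?n = "CARD('n)"
  let ?C = "unit_ball_vol (2 * real ?n) * A ^ ?n * (2 * A)"
  show "?C > 0" using A by simp
  fix t :: real assume t: "t \<ge> 1"
  define R where "R = A * t"
  have R: "R > 0" using A t by (simp add: R_def)
  let ?S = "cball (0 :: complex ^ 'n) (sqrt R) \<times> {-R..R}"
  have "ennreal (LINT x|lborel. cutoff R (x :: 'n heis)) = (\<integral>\<^sup>+x. ennreal (cutoff R (x :: 'n heis)) \<partial>lborel)"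
    using cutoff_bounds(1) by (intro nn_integral_eq_integral[symmetric] integrable_cutoff R AE_I2)
  also have "\<dots> \<le> (\<integral>\<^sup>+x. indicator ?S x \<partial>lborel)"
  proof (rule nn_integral_mono)
    fix x :: "'n heis"
    show "ennreal (cutoff R x) \<le> indicator ?S x"
    proof (cases "hgauge x < R")
      case True
      then have "norm (fst x) \<le> sqrt R" "\<bar>snd x\<bar> \<le> R"
        using hgauge_ge(1,2)[of x] by (auto intro: real_le_rsqrt)
      then have "x \<in> ?S" by (auto simp: mem_Times_iff abs_le_iff)
      then show ?thesis using cutoff_bounds(2)[OF R, of x] by (simp add: ennreal_le_1)
    next
      case False
      then show ?thesis using cutoff_eq_0[OF R, of x] by simp
    qed
  qed
  also have "\<dots> = emeasure (lborel \<Otimes>\<^sub>M lborel) ?S"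
    by (simp add: lborel_prod borel_closed closed_Times)
  also have "\<dots> = emeasure lborel (cball (0 :: complex ^ 'n) (sqrt R)) * emeasure lborel {-R..R}"
    by (intro lborel.emeasure_pair_measure_Times) auto
  also have "\<dots> = ennreal (unit_ball_vol (2 * real ?n) * sqrt R ^ (2 * ?n)) * ennreal (2 * R)"
    using R by (simp add: emeasure_cball mult.commute)
  also have "\<dots> = ennreal (unit_ball_vol (2 * real ?n) * R ^ ?n * (2 * R))"
    using R by (simp add: power_mult ennreal_mult'')
  finally have "(LINT x|lborel. cutoff R (x :: 'n heis)) \<le> unit_ball_vol (2 * real ?n) * R ^ ?n * (2 * R)"
    using R by (subst (asm) ennreal_le_iff) auto
  also have "\<dots> = ?C * t ^ (?n + 1)"
    by (simp add: R_def power_mult_distrib)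
  also have "\<dots> \<le> ?C * t ^ (2 * ?n)"
  proof (intro mult_left_mono power_increasing)
    show "?n + 1 \<le> 2 * ?n" using zero_less_card_finite[where 'a = 'n] by linarith
  qed (use A t in auto)
  finally show "(LINT x|lborel. cutoff (A * t) (x :: 'n heis)) \<le> ?C * t ^ (2 * ?n)"
    by (simp add: R_def)
qed

section \<open>Growth of the weighted mass of a global solution\<close>

theorem theorem4p2:
  fixes p :: "real \<Rightarrow> 'n::finite heis \<Rightarrow> real"
    and f \<phi> :: "real \<Rightarrow> real"
    and u\<^sub>0 :: "'n heis \<Rightarrow> real"
  assumes "heat_kernel p"
    and "continuous_on {0..} f" "convex_on {0..} f" "f 0 = 0" "\<And>v. v > 0 \<Longrightarrow> f v > 0"
    and "(\<integral>\<^sup>+v\<in>{1..}. ennreal (1 / f_minor f v) \<partial>lborel) < \<infinity>"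
    and "continuous_on {0..} \<phi>" "\<And>t. t \<ge> 0 \<Longrightarrow> \<phi> t \<ge> 0"
    and "\<And>\<epsilon>. \<epsilon> > 0 \<Longrightarrow>
      (\<integral>\<^sup>+\<tau>\<in>{1..}. ennreal (\<phi> \<tau> * \<tau> ^ (2 * CARD('n)) * f (\<epsilon> / \<tau> ^ (2 * CARD('n)))) \<partial>lborel) = \<infinity>"
    and "\<And>x. u\<^sub>0 x > 0" "u\<^sub>0 \<in> C0" "integrable lborel u\<^sub>0"
  shows "\<not> (\<exists>u. global_solution p \<phi> f u\<^sub>0 u)"
proof
  note p = assms(1) and f = assms(2-5) and \<phi> = assms(7,8) and u0 = assms(10,11)
  assume "\<exists>u. global_solution p \<phi> f u\<^sub>0 u"
  then obtain u where u: "global_solution p \<phi> f u\<^sub>0 u" ..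
  let ?HS = "heat_semigroup p"
  let ?F = "\<lambda>\<tau> y. \<phi> \<tau> * f (u \<tau> y)"
  have sol: "mild_solution p \<phi> f u\<^sub>0 \<infinity> u"
    and uess: "\<And>t. t > 0 \<Longrightarrow> esssup lborel (\<lambda>x. ereal \<bar>u t x\<bar>) < \<infinity>"
    using u unfolding global_solution_def by blast+
  have upos: "0 < u t x"
    and Fint: "set_integrable lborel {0<..<t} (\<lambda>\<tau>. ?HS (t - \<tau>) (?F \<tau>) x)"
    and ueq: "u t x = ?HS t u\<^sub>0 x + (LINT \<tau>:{0<..<t}|lborel. ?HS (t - \<tau>) (?F \<tau>) x)" if "t > 0" for t x
  proof -
    have "0 < t \<and> ereal t < \<infinity>" using that by simp
    note this[THEN sol[unfolded mild_solution_def, THEN spec, THEN spec, THEN mp]]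
    then show "0 < u t x" "set_integrable lborel {0<..<t} (\<lambda>\<tau>. ?HS (t - \<tau>) (?F \<tau>) x)"
      "u t x = ?HS t u\<^sub>0 x + (LINT \<tau>:{0<..<t}|lborel. ?HS (t - \<tau>) (?F \<tau>) x)"
      by blast+
  qed
  have um: "u t \<in> borel_measurable borel" if "t > 0" for t
  proof -
    \<comment> \<open>The essential supremum sees only the absolute value; positivity recovers
      \<open>u t\<close> itself.\<close>
    have "(\<lambda>x. \<bar>u t x\<bar>) = u t" using upos[OF that] by (auto simp: abs_of_pos)
    then show ?thesis using AE_bounded_of_esssup(1)[OF uess[OF that]] by simp
  qed
  have ub: "\<exists>B. AE x in lborel. \<bar>u t x\<bar> \<le> B" if "t > 0" for t
    by (rule AE_bounded_of_esssup(2)[OF uess[OF that]])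
  have f_ge: "0 \<le> f v" if "0 \<le> v" for v
    by (rule f_nonneg[OF f(2-4) that])
  have fm: "(\<lambda>y. f (u t y)) \<in> borel_measurable borel" if "t > 0" for t
  proof -
    have "(\<lambda>v. f (max 0 v)) \<in> borel_measurable borel"
      by (intro borel_measurable_continuous_onI continuous_on_compose2[OF f(1)] continuous_intros) auto
    then have "(\<lambda>x. f (max 0 (u t x))) \<in> borel_measurable borel"
      by (rule measurable_compose[OF um[OF that]])
    then show ?thesis using upos[OF that] by (simp add: max_absorb2 less_imp_le)
  qed
  have Fm: "?F t \<in> borel_measurable borel" if "t > 0" for t
    using fm[OF that] by simp
  have F0: "0 \<le> ?F t y" if "t > 0" for t y
    using f_ge \<phi>(2) upos[OF that] that by (simp add: less_imp_le)
  have Fb: "\<exists>B. AE y in lborel. \<bar>?F t y\<bar> \<le> B" if t: "t > 0" for t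
  proof -
    obtain B where B: "AE x in lborel. \<bar>u t x\<bar> \<le> B" using ub[OF t] ..
    have "AE y in lborel. \<bar>?F t y\<bar> \<le> \<phi> t * f B"
      using B
    proof eventually_elim
      case (elim y)
      then have "f (u t y) \<le> f B"
        using f_mono[OF f(2-4), of "u t y" B] upos[OF t, of y] by simp
      then have "?F t y \<le> \<phi> t * f B"
        using \<phi>(2)[of t] t by (intro mult_left_mono) auto
      then show ?case using F0[OF t, of y] by simp
    qed
    then show ?thesis ..
  qed
  have u0m: "u\<^sub>0 \<in> borel_measurable borel"
    using u0(2) by (auto simp: C0_def intro: borel_measurable_continuous_onI)
  obtain B0 where B0: "AE y in lborel. \<bar>u\<^sub>0 y\<bar> \<le> B0"
    using C0_bounded[OF u0(2)] by auto

  define D where "D = 8 + 4 * real CARD('n)"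
  \<comment> \<open>With radius \<open>A * t\<close> the loss \<open>D * s / R\<close> over a
    duration \<open>s\<close> becomes \<open>s / (2 * t)\<close>, at most one half when
    \<open>s\<close> is at most \<open>t\<close>.\<close>
  define A where "A = 2 * D"
  have A: "A \<ge> 16" by (simp add: A_def D_def)
  let ?w = "\<lambda>t. cutoff (A * t) :: 'n heis \<Rightarrow> real"
  have spread: "(LINT z|lborel. p s z * ?w t (hmul y z)) \<ge> max 0 (1 - hgauge y / (A * t)) - s / (2 * t)"
    if "s > 0" "t > 0" for s t and y :: "'n heis"
  proof -
    have "D / (A * t) * s = s / (2 * t)" using A by (simp add: A_def)
    then show ?thesis
      using heat_kernel_hgauge[OF p that(1), of "A * t" y] that A by (simp add: cutoff_def D_def)
  qed
  have half: "(LINT z|lborel. p (t - \<tau>) z * ?w t (hmul y z)) \<ge> 1 / 2 * ?w \<tau> y"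
    if \<tau>: "0 < \<tau>" "\<tau> < t" for t \<tau> y
  proof (cases "hgauge y / A \<le> \<tau>")
    case True
    define r where "r = hgauge y / A"
    have r: "0 \<le> r" "r \<le> \<tau>" using True hgauge_pos[of y] A by (auto simp: r_def)
    \<comment> \<open>Multiplied by \<open>2 * t * \<tau>\<close>, the claim says that
      \<open>\<tau> * (\<tau> - r) + r * (t - \<tau>)\<close> is nonnegative.\<close>
    have "1 / 2 * (1 - r / \<tau>) \<le> (1 - r / t) - (t - \<tau>) / (2 * t)"
    proof -
      have "r * \<tau> \<le> \<tau> * \<tau>" "r * \<tau> \<le> r * t"
        using r \<tau> by (auto intro: mult_right_mono mult_left_mono)
      then have "0 \<le> \<tau> * \<tau> + r * t - 2 * r * \<tau>" by simp
      then have "0 \<le> (\<tau> * \<tau> + r * t - 2 * r * \<tau>) / (2 * t * \<tau>)"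
        using \<tau> by (intro divide_nonneg_pos) auto
      also have "\<dots> = (1 - r / t) - (t - \<tau>) / (2 * t) - 1 / 2 * (1 - r / \<tau>)"
        using \<tau> by (simp add: divide_simps) (simp add: algebra_simps)
      finally show ?thesis by simp
    qed
    also have "\<dots> \<le> max 0 (1 - hgauge y / (A * t)) - (t - \<tau>) / (2 * t)"
      by (simp add: r_def)
    also have "\<dots> \<le> (LINT z|lborel. p (t - \<tau>) z * ?w t (hmul y z))"
      using \<tau> by (intro spread) auto
    finally have "1 / 2 * (1 - r / \<tau>) \<le> (LINT z|lborel. p (t - \<tau>) z * ?w t (hmul y z))" .
    moreover have "?w \<tau> y = 1 - r / \<tau>"
    proof -
      have "r / \<tau> \<le> 1" using r \<tau> by simp
      moreover have "hgauge y / (A * \<tau>) = r / \<tau>" by (simp add: r_def)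
      ultimately show ?thesis by (simp add: cutoff_def)
    qed
    ultimately show ?thesis by simp
  next
    case False
    then have "?w \<tau> y = 0"
      using A \<tau> by (intro cutoff_eq_0) (auto simp: field_simps)
    moreover have "0 \<le> (LINT z|lborel. p (t - \<tau>) z * ?w t (hmul y z))"
      using p \<tau> by (intro Bochner_Integration.integral_nonneg mult_nonneg_nonneg cutoff_bounds(1)) (auto intro: less_imp_le[OF heat_kernel_pos])
    ultimately show ?thesis by simp
  qed
  \<comment> \<open>The full duration \<open>t\<close> costs 1/2, and a start with gauge below
    \<open>A / 4\<close> costs at most 1/4, which leaves 1/4. The set does not depend on
    \<open>t\<close>, so the initial value contributes a fixed mass at all times.\<close>
  have quarter: "(LINT z|lborel. p t z * ?w t (hmul y z)) \<ge> indicator {y. hgauge y < A / 4} y / 4"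
    if t: "t \<ge> 1" for t y
  proof (cases "hgauge y < A / 4")
    case True
    moreover have "A \<le> A * t" using A t by simp
    ultimately have "hgauge y * 4 \<le> A * t" by linarith
    then have "hgauge y / (A * t) \<le> 1 / 4"
      using A t by (simp add: divide_simps)
    moreover have "t / (2 * t) = 1 / 2" using t by simp
    moreover have "1 - hgauge y / (A * t) \<le> max 0 (1 - hgauge y / (A * t))" by simp
    ultimately have "1 / 4 \<le> max 0 (1 - hgauge y / (A * t)) - t / (2 * t)"
      by linarith
    also have "\<dots> \<le> (LINT z|lborel. p t z * ?w t (hmul y z))"
      using t by (intro spread) auto
    finally show ?thesis using True by simp
  next
    case False
    have "0 \<le> (LINT z|lborel. p t z * ?w t (hmul y z))"
      using p t by (intro Bochner_Integration.integral_nonneg mult_nonneg_nonneg cutoff_bounds(1)) (auto intro: less_imp_le[OF heat_kernel_pos])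
    then show ?thesis using False by simp
  qed

  obtain C where C: "C > 0" "\<And>t. t \<ge> 1 \<Longrightarrow> (LINT x|lborel. ?w t x) \<le> C * t ^ (2 * CARD('n))"
    using integral_cutoff_le[of A] A by auto
  define \<mu> where "\<mu> = (\<integral>\<^sup>+y. ennreal (u\<^sub>0 y) * ennreal (indicator {y. hgauge y < A / 4} y / 4) \<partial>lborel)"
  have op: "open {y :: 'n heis. hgauge y < A / 4}"
    by (intro open_Collect_less continuous_intros)
  have "\<mu> \<noteq> 0"
  proof
    assume "\<mu> = 0"
    then have "AE y in lborel. ennreal (u\<^sub>0 y) * ennreal (indicator {y. hgauge y < A / 4} y / 4) = 0"
      unfolding \<mu>_def using u0m op by (subst (asm) nn_integral_0_iff_AE) auto
    then have ae: "AE y in lborel. y \<notin> {y :: 'n heis. hgauge y < A / 4}"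
    proof eventually_elim
      case (elim y)
      then show ?case using u0(1)[of y] by (auto simp: ennreal_eq_0_iff not_le)
    qed
    from open_AE_imp_empty[OF op ae] have "\<not> hgauge (0 :: 'n heis) < A / 4" by blast
    \<comment> \<open>The identity has gauge 1, while \<open>A / 4\<close> is at least 4.\<close>
    then show False using A by (simp add: hgauge_def)
  qed
  \<comment> \<open>The cap makes the mass finite and smaller than \<open>C\<close>, as the use of
    \<open>f_minor\<close> at \<open>m0 / V\<close> demands.\<close>
  define m0 where "m0 = enn2real (min \<mu> (ennreal (C / 2)))"
  have m0_eq: "ennreal m0 = min \<mu> (ennreal (C / 2))"
    unfolding m0_def by (intro ennreal_enn2real) (simp add: min_less_iff_disj)
  have m0: "0 < m0" "m0 < C" "ennreal m0 \<le> \<mu>"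
  proof -
    have "0 < ennreal m0" unfolding m0_eq using \<open>\<mu> \<noteq> 0\<close> C by (simp add: zero_less_iff_neq_zero)
    then show "0 < m0" by simp
    have "ennreal m0 \<le> ennreal (C / 2)" unfolding m0_eq by simp
    then have "m0 \<le> C / 2" using C by (subst (asm) ennreal_le_iff) auto
    then show "m0 < C" using C by simp
    show "ennreal m0 \<le> \<mu>" unfolding m0_eq by simp
  qed

  define m where "m = (\<lambda>t. LINT x|lborel. u t x * ?w t x)"
  have main: "ennreal m0 + (\<integral>\<^sup>+\<tau>\<in>{1<..<t}. ennreal (1 / 2 * \<phi> \<tau> * (C * \<tau> ^ (2 * CARD('n))) * f (m \<tau> / (C * \<tau> ^ (2 * CARD('n))))) \<partial>lborel)
      \<le> ennreal (m t)" if t: "t \<ge> 1" for t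
  proof -
    have t0: "t > 0" and At: "A * t > 0" using t A by auto
    \<comment> \<open>The indicator removes the times at which the kernel would be evaluated at a
      nonpositive argument, where nothing is known about it.\<close>
    define H where "H = (\<lambda>\<tau> x. indicator {0<..<t} \<tau> *\<^sub>R ?HS (t - \<tau>) (?F \<tau>) x)"
    have HS0: "0 \<le> ?HS (t - \<tau>) (?F \<tau>) x" if "\<tau> \<in> {0<..<t}" for \<tau> x
      using that by (intro heat_semigroup_nonneg[OF p] F0) auto
    have H0: "0 \<le> H \<tau> x" for \<tau> x
      using HS0 by (simp add: H_def indicator_def)
    have HS00: "0 \<le> ?HS t u\<^sub>0 x" for x
      by (intro heat_semigroup_nonneg[OF p t0] less_imp_le[OF u0(1)])
    have Hi: "integrable lborel (\<lambda>\<tau>. H \<tau> x)" for x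
      using Fint[OF t0, of x] by (simp add: set_integrable_def H_def)
    have cH: "continuous_on UNIV (H \<tau>)" for \<tau>
    proof (cases "\<tau> \<in> {0<..<t}")
      case True
      then obtain B where "AE y in lborel. \<bar>?F \<tau> y\<bar> \<le> B" using Fb[of \<tau>] by auto
      then have "continuous_on UNIV (?HS (t - \<tau>) (?F \<tau>))"
        using True by (intro heat_semigroup_bounded(2)[OF p] Fm) auto
      then show ?thesis using True by (simp add: H_def)
    qed (simp add: H_def)
    have Hm: "(\<lambda>(\<tau>, x). H \<tau> x) \<in> borel_measurable (lborel \<Otimes>\<^sub>M borel)"
      by (rule borel_measurable_Caratheodory[OF borel_measurable_integrable[OF Hi] cH])
    then have Hm': "(\<lambda>(\<tau>, x). H \<tau> x) \<in> borel_measurable (lborel \<Otimes>\<^sub>M lborel)"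
      by (simp cong: measurable_cong_sets sets_pair_measure_cong)
    have [measurable]: "(\<lambda>z. H (fst z) (snd z)) \<in> borel_measurable (lborel \<Otimes>\<^sub>M lborel)"
      using Hm' by (simp add: case_prod_beta')
    have Hm1 [measurable]: "(\<lambda>\<tau>. H \<tau> x) \<in> borel_measurable borel" for x
      using borel_measurable_integrable[OF Hi] by simp
    have [measurable]: "H \<tau> \<in> borel_measurable borel" for \<tau>
      by (rule borel_measurable_continuous_onI[OF cH])
    have [measurable]: "?w s \<in> borel_measurable borel" for s
      by (rule borel_measurable_continuous_onI[OF continuous_cutoff])
    have [measurable]: "?HS t u\<^sub>0 \<in> borel_measurable borel"
      by (rule borel_measurable_continuous_onI[OF heat_semigroup_bounded(2)[OF p t0 u0m B0]])
    have w0: "0 \<le> ?w s x" for s x by (rule cutoff_bounds)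
    have iu: "integrable lborel (\<lambda>x. u t x * ?w t x)"
    proof -
      obtain B where B: "AE x in lborel. \<bar>u t x\<bar> \<le> B" using ub[OF t0] ..
      show ?thesis
      proof (rule Bochner_Integration.integrable_bound)
        show "integrable lborel (\<lambda>x. B * ?w t x)" by (simp add: integrable_cutoff[OF At])
        show "(\<lambda>x. u t x * ?w t x) \<in> borel_measurable lborel" using um[OF t0] by simp
        show "AE x in lborel. norm (u t x * ?w t x) \<le> norm (B * ?w t x)"
          using B by eventually_elim (use w0 in \<open>auto simp: abs_mult intro!: mult_right_mono\<close>)
      qed
    qed
    have m_eq: "ennreal (m t) = (\<integral>\<^sup>+x. ennreal (u t x) * ennreal (?w t x) \<partial>lborel)"
      unfolding m_def using w0 upos[OF t0]
      by (subst nn_integral_eq_integral[OF iu, symmetric]) (auto simp: less_imp_le ennreal_mult intro!: nn_integral_cong)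
    \<comment> \<open>All terms are nonnegative and the Duhamel integrand is integrable, so the
      Bochner integral is the true value here and not a default 0.\<close>
    have u_eq: "ennreal (u t x) = ennreal (?HS t u\<^sub>0 x) + (\<integral>\<^sup>+\<tau>. ennreal (H \<tau> x) \<partial>lborel)" for x
    proof -
      have "(\<integral>\<^sup>+\<tau>. ennreal (H \<tau> x) \<partial>lborel) = ennreal (LINT \<tau>|lborel. H \<tau> x)"
        using H0 by (intro nn_integral_eq_integral Hi) auto
      moreover have "u t x = ?HS t u\<^sub>0 x + (LINT \<tau>|lborel. H \<tau> x)"
        using ueq[OF t0, of x] by (simp add: set_lebesgue_integral_def H_def)
      ultimately show ?thesis
        using HS00 H0 by (simp add: ennreal_plus Bochner_Integration.integral_nonneg)
    qed
    have "ennreal (m t) = (\<integral>\<^sup>+x. ennreal (?HS t u\<^sub>0 x) * ennreal (?w t x)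
        + (\<integral>\<^sup>+\<tau>. ennreal (H \<tau> x) \<partial>lborel) * ennreal (?w t x) \<partial>lborel)"
      unfolding m_eq u_eq by (simp add: distrib_right)
    also have "\<dots> = (\<integral>\<^sup>+x. ennreal (?HS t u\<^sub>0 x) * ennreal (?w t x) \<partial>lborel)
        + (\<integral>\<^sup>+x. (\<integral>\<^sup>+\<tau>. ennreal (H \<tau> x) \<partial>lborel) * ennreal (?w t x) \<partial>lborel)"
    proof (rule nn_integral_add)
      have "(\<lambda>x. \<integral>\<^sup>+\<tau>. ennreal (H \<tau> x) \<partial>lborel) \<in> borel_measurable lborel"
        using measurable_compose[OF measurable_pair_swap' Hm']
        by (intro lborel.borel_measurable_nn_integral) (simp add: case_prod_beta')
      then show "(\<lambda>x. (\<integral>\<^sup>+\<tau>. ennreal (H \<tau> x) \<partial>lborel) * ennreal (?w t x)) \<in> borel_measurable lborel"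
        by measurable
    qed measurable
    also have "(\<integral>\<^sup>+x. (\<integral>\<^sup>+\<tau>. ennreal (H \<tau> x) \<partial>lborel) * ennreal (?w t x) \<partial>lborel)
        = (\<integral>\<^sup>+x. (\<integral>\<^sup>+\<tau>. ennreal (H \<tau> x) * ennreal (?w t x) \<partial>lborel) \<partial>lborel)"
      by (intro nn_integral_cong nn_integral_multc[symmetric]) simp
    also have "\<dots> = (\<integral>\<^sup>+\<tau>. (\<integral>\<^sup>+x. ennreal (H \<tau> x) * ennreal (?w t x) \<partial>lborel) \<partial>lborel)"
      by (rule lborel_pair.Fubini') (simp add: case_prod_beta')
    finally have mt: "ennreal (m t) = (\<integral>\<^sup>+x. ennreal (?HS t u\<^sub>0 x) * ennreal (?w t x) \<partial>lborel)
        + (\<integral>\<^sup>+\<tau>. (\<integral>\<^sup>+x. ennreal (H \<tau> x) * ennreal (?w t x) \<partial>lborel) \<partial>lborel)" .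
    have "ennreal m0 \<le> (\<integral>\<^sup>+x. ennreal (?HS t u\<^sub>0 x) * ennreal (?w t x) \<partial>lborel)"
    proof (rule order_trans[OF m0(3)])
      show "\<mu> \<le> (\<integral>\<^sup>+x. ennreal (?HS t u\<^sub>0 x) * ennreal (?w t x) \<partial>lborel)"
        unfolding \<mu>_def
        by (rule nn_integral_heat_semigroup[OF p t0 u0m B0 less_imp_le[OF u0(1)] continuous_cutoff w0 quarter[OF t] cutoff_bounds(2)[OF At]])
    qed
    moreover have "(\<integral>\<^sup>+\<tau>\<in>{1<..<t}. ennreal (1 / 2 * \<phi> \<tau> * (C * \<tau> ^ (2 * CARD('n))) * f (m \<tau> / (C * \<tau> ^ (2 * CARD('n))))) \<partial>lborel)
        \<le> (\<integral>\<^sup>+\<tau>. (\<integral>\<^sup>+x. ennreal (H \<tau> x) * ennreal (?w t x) \<partial>lborel) \<partial>lborel)"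
    proof (rule nn_integral_mono)
      fix \<tau> :: real
      let ?V = "C * \<tau> ^ (2 * CARD('n))"
      show "ennreal (1 / 2 * \<phi> \<tau> * ?V * f (m \<tau> / ?V)) * indicator {1<..<t} \<tau>
          \<le> (\<integral>\<^sup>+x. ennreal (H \<tau> x) * ennreal (?w t x) \<partial>lborel)"
      \<comment> \<open>The source outside (1, t) is discarded, its contribution being nonnegative:
        \<open>C\<close> bounds the mass of the weight only from time 1 on.\<close>
      proof (cases "\<tau> \<in> {1<..<t}")
        case True
        then have \<tau>: "0 < \<tau>" "\<tau> < t" "1 \<le> \<tau>" by auto
        obtain B where B: "AE y in lborel. \<bar>?F \<tau> y\<bar> \<le> B" using Fb[OF \<tau>(1)] ..
        obtain B' where B': "AE x in lborel. \<bar>u \<tau> x\<bar> \<le> B'" using ub[OF \<tau>(1)] ..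
        have "A \<le> A * \<tau>" using A \<tau>(3) by simp
        then have A\<tau>: "A * \<tau> > 1" using A by linarith
        have "ennreal (?V * f (m \<tau> / ?V)) \<le> (\<integral>\<^sup>+y. ennreal (f (u \<tau> y)) * ennreal (?w \<tau> y) \<partial>lborel)"
          unfolding m_def
        proof (rule jensen_weighted[OF f _ _ B'])
          show "u \<tau> \<in> borel_measurable lborel" using um[OF \<tau>(1)] by simp
          show "integrable lborel (?w \<tau>)" using A\<tau> by (intro integrable_cutoff) simp
        qed (use upos[OF \<tau>(1)] w0 integral_cutoff_pos[OF A\<tau>] C(2)[OF \<tau>(3)] in \<open>auto simp: less_imp_le\<close>)
        then have "ennreal (\<phi> \<tau> / 2) * ennreal (?V * f (m \<tau> / ?V))
            \<le> ennreal (\<phi> \<tau> / 2) * (\<integral>\<^sup>+y. ennreal (f (u \<tau> y)) * ennreal (?w \<tau> y) \<partial>lborel)"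
          by (rule mult_left_mono) simp
        also have "\<dots> = (\<integral>\<^sup>+y. ennreal (?F \<tau> y) * ennreal (1 / 2 * ?w \<tau> y) \<partial>lborel)"
        proof (subst nn_integral_cmult[symmetric])
          show "(\<lambda>y. ennreal (f (u \<tau> y)) * ennreal (?w \<tau> y)) \<in> borel_measurable lborel"
            using fm[OF \<tau>(1)] by simp
          show "(\<integral>\<^sup>+y. ennreal (\<phi> \<tau> / 2) * (ennreal (f (u \<tau> y)) * ennreal (?w \<tau> y)) \<partial>lborel)
              = (\<integral>\<^sup>+y. ennreal (?F \<tau> y) * ennreal (1 / 2 * ?w \<tau> y) \<partial>lborel)"
          proof (rule nn_integral_cong)
            fix y
            have "0 \<le> \<phi> \<tau>" "0 \<le> f (u \<tau> y)" using \<phi>(2) \<tau> f_ge upos[OF \<tau>(1), of y] by auto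
            then show "ennreal (\<phi> \<tau> / 2) * (ennreal (f (u \<tau> y)) * ennreal (?w \<tau> y)) = ennreal (?F \<tau> y) * ennreal (1 / 2 * ?w \<tau> y)"
              using w0[of \<tau> y] by (simp add: ennreal_mult[symmetric] mult_ac)
          qed
        qed
        also have "\<dots> \<le> (\<integral>\<^sup>+x. ennreal (?HS (t - \<tau>) (?F \<tau>) x) * ennreal (?w t x) \<partial>lborel)"
          using \<tau>
          by (intro nn_integral_heat_semigroup[OF p _ Fm B F0 continuous_cutoff w0 half cutoff_bounds(2)[OF At]]) auto
        also have "\<dots> = (\<integral>\<^sup>+x. ennreal (H \<tau> x) * ennreal (?w t x) \<partial>lborel)"
          using \<tau> by (simp add: H_def)
        finally have "ennreal (\<phi> \<tau> / 2) * ennreal (?V * f (m \<tau> / ?V))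
            \<le> (\<integral>\<^sup>+x. ennreal (H \<tau> x) * ennreal (?w t x) \<partial>lborel)" .
        moreover have "ennreal (1 / 2 * \<phi> \<tau> * ?V * f (m \<tau> / ?V)) = ennreal (\<phi> \<tau> / 2) * ennreal (?V * f (m \<tau> / ?V))"
          using \<phi>(2)[of \<tau>] \<tau> by (simp add: ennreal_mult'[symmetric] mult.assoc)
        ultimately show ?thesis using True by simp
      qed simp
    qed
    ultimately show ?thesis
      unfolding mt by (rule add_mono)
  qed
  show False
    by (rule integral_inequality_blowup[OF f(2-4) f(1) assms(6) \<phi> assms(9) _ m0(1,2) main]) auto
qed

end
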